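(* Let $q\in\{\prime,\prime\prime\}$, let $M^{q}$ be the glued manifold described in the context, with quadrilateral $A^{q}B^{q}C^{q}D^{q}$ and interior point $P_F$, where $P_F$ lies in the interior of the triangle $\triangle A^qB^qC^q$. Let $c>0$ and let $(w_{R})_{A^{q}B^{q}C^{q}D^{q}}$, $R\in\{A^q,B^q,C^q,D^q\}$, be any positive weights solving the 4-inverse weighted Fermat-Torricelli problem on $M^{q}$ for $A^{q}B^{q}C^{q}D^{q}$, $P_F$ and $c$. Then $$\left(\frac{w_{B^{q}}}{w_{A^{q}}}\right)_{A^{q}B^{q}C^{q}D^{q}}=\left(\frac{w_{B^{q}}}{w_{A^{q}}}\right)_{A^{q}B^{q}C^{q}}\left[1-\left(\frac{w_{D^{q}}}{w_{A^{q}}}\right)_{A^{q}B^{q}C^{q}D^{q}}\left(\frac{w_{A^{q}}}{w_{D^{q}}}\right)_{A^{q}C^{q}D^{q}}\right],$$ $$\left(\frac{w_{C^{q}}}{w_{A^{q}}}\right)_{A^{q}B^{q}C^{q}D^{q}}=\left(\frac{w_{C^{q}}}{w_{A^{q}}}\right)_{A^{q}B^{q}C^{q}}\left[1-\left(\frac{w_{D^{q}}}{w_{A^{q}}}\right)_{A^{q}B^{q}C^{q}D^{q}}\left(\frac{w_{A^{q}}}{w_{D^{q}}}\right)_{A^{q}B^{q}D^{q}}\right],$$ and $$(w_{A^{q}})_{A^{q}B^{q}C^{q}D^{q}}+(w_{B^{q}})_{A^{q}B^{q}C^{q}D^{q}}+(w_{C^{q}})_{A^{q}B^{q}C^{q}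D^{q}}+(w_{D^{q}})_{A^{q}B^{q}C^{q}D^{q}}=c.$$
   Context: Let $0<K_1<K_2$ and let $M$ be a complete convex surface in $\mathbb{R}^3$ (the whole boundary of a convex body) whose specific curvature $\kappa(W)=\omega(W)/S(W)$ (curvature $\omega(W)=\iint_WK\,dS$ divided by area $S(W)$ of the domain $W$) satisfies $K_1<\kappa(W)<K_2$. Write $S_{K_i}$ for the two-dimensional sphere of constant Gaussian curvature $K_i$. A triangle has sides that are shortest arcs. The manifolds $M^q$ are obtained by gluing four triangles $\triangle A^qP_FD^q$, $\triangle D^qP_FC^q$, $\triangle C^qP_FB^q$, $\triangle B^qP_FA^q$ along the common sides $P_FA^q,P_FB^q,P_FC^q,P_FD^q$ around the common vertex $P_F$, such that the sum of the angles meeting at $P_F$ equals $2\pi$; the glued triangles form the quadrilateral $A^qB^qC^qD^q$ (vertices in this cyclic order) containing $P_F$ in its interior: (1) $M'$: two of the triangles ($\triangle A'P_FD'$, $\triangle D'P_FC'$) lie on $S_{K_1}$ and two ($\triangle C'P_FB'$, $\triangle B'P_FA'$) lie on $S_{K_2}$; they are comparison triangles (same side lengths) of triangles $\triangle AP_FD,\triangle DP_FC,\triangle CP_FB,\triangle BP_FA$ on $M$ respectively. (2) $M''$: two of the triangles are the triangles $\triangle AP_FD$, $\triangle DP_FC$ on $M$, one ($\triangle C''P_FB''$) is the comparison triangle of $\triangle CP_FB$ on $S_{K_1}$ and one ($\triangle B''P_FA''$) is the comparison triangle of $\triangle BP_FA$ on $S_{K_2}$. Here $ABCD$ is a convex quadrilateral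 on $M$ (perimeter less than $2\pi/\sqrt{K_1}$) with $P_F$ in its interior. 4-inverse weighted Fermat-Torricelli problem on $M^q$: given $c>0$, find positive weights $w_R$, $R\in\{A^q,B^q,C^q,D^q\}$, with sum $c$ such that $P_F$ is the weighted Fermat-Torricelli point of $A^qB^qC^qD^q$, i.e. $P_F$ minimizes $f(P)=\sum_R w_R l_R$ where $l_R$ is the length of the shortest arc from $P$ to $R$. Solutions are denoted $(w_R)_{A^qB^qC^qD^q}$, with $\left(\frac{w_R}{w_S}\right)_{A^qB^qC^qD^q}$ the ratio of the two weights. Let $u_R$ be the unit direction at $P_F$ of the shortest arc $P_FR$, in the Euclidean plane of directions at $P_F$ (total angle $2\pi$). For distinct $S,L,N\in\{A^q,B^q,C^q,D^q\}$, the numbers $(w_S)_{SLN},(w_L)_{SLN},(w_N)_{SLN}$ are the real numbers with sum $c$ and $(w_S)_{SLN}u_S+(w_L)_{SLN}u_L+(w_N)_{SLN}u_N=0$ (solution of the 3-inverse problem for $\triangle SLN$ at $P_F$; they may be negative or zero if $P_F$ is not interior to $\triangle SLN$), and $\left(\frac{w_S}{w_L}\right)_{SLN}=(w_S)_{SLN}/(w_L)_{SLN}$. *)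

theory Defs
  imports "HOL-Analysis.Analysis"
begin

type_synonym point = "real ^ 3"

section \<open>Intrinsic metric, shortest arcs, geodesic polygons\<close>

definition curve_length :: "(real \<Rightarrow> point) \<Rightarrow> ennreal" where
  "curve_length g =
     (SUP (n, \<tau>) \<in> {(n :: nat, \<tau> :: nat \<Rightarrow> real). mono \<tau> \<and> range \<tau> \<subseteq> {0..1}}.
        \<Sum>i<n. ennreal (dist (g (\<tau> i)) (g (\<tau> (Suc i)))))"

text \<open>Induced length metric of a set \<open>X\<close>; it is \<open>\<infinity>\<close> if no curve of finite length in \<open>X\<close> joins the points.\<close>
definition inner_dist :: "point set \<Rightarrow> point \<Rightarrow> point \<Rightarrow> ennreal" where
  "inner_dist X x y =
     (INF g \<in> {g. path g \<and> path_image g \<subseteq> X \<and> pathstart g = x \<and> pathfinish g = y}. curve_length g)"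

definition idist :: "point set \<Rightarrow> point \<Rightarrow> point \<Rightarrow> real" where
  "idist X x y = enn2real (inner_dist X x y)"

text \<open>The notions of this part refer to a set \<open>X\<close> with a metric \<open>d\<close>: they are used both for surfaces in
  space with their intrinsic metric and for the glued manifolds. Arcs are treated as point sets.\<close>

definition shortest_arc :: "'a set \<Rightarrow> ('a \<Rightarrow> 'a \<Rightarrow> real) \<Rightarrow> 'a set \<Rightarrow> 'a \<Rightarrow> 'a \<Rightarrow> bool" where
  "shortest_arc X d S x y \<longleftrightarrow>
     (\<exists>L\<ge>0. \<exists>g. g ` {0..L} = S \<and> S \<subseteq> X \<and> g 0 = x \<and> g L = y \<and>
        (\<forall>s\<in>{0..L}. \<forall>t\<in>{0..L}. d (g s) (g t) = \<bar>s - t\<bar>))"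

definition geodesically_convex :: "'a set \<Rightarrow> ('a \<Rightarrow> 'a \<Rightarrow> real) \<Rightarrow> 'a set \<Rightarrow> bool" where
  "geodesically_convex X d T \<longleftrightarrow>
     T \<subseteq> X \<and> (\<forall>x\<in>T. \<forall>y\<in>T. \<exists>S. shortest_arc X d S x y \<and> S \<subseteq> T)"

text \<open>\<open>T\<close> is a closed disc bounded by the simple closed curve formed by the sides \<open>Ss\<close>, where \<open>Ss ! i\<close> is a
  shortest arc of \<open>X\<close> from \<open>ps ! i\<close> to the cyclically next vertex.\<close>
definition geodesic_polygon ::
  "'a set \<Rightarrow> ('a \<Rightarrow> 'a \<Rightarrow> real) \<Rightarrow> 'a list \<Rightarrow> 'a set list \<Rightarrow> 'a set \<Rightarrow> bool" where
  "geodesic_polygon X d ps Ss T \<longleftrightarrow>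
     length Ss = length ps \<and> distinct ps \<and> T \<subseteq> X \<and>
     (\<forall>i<length ps. shortest_arc X d (Ss ! i) (ps ! i) (ps ! (Suc i mod length ps))) \<and>
     (\<forall>i<length ps. Ss ! i \<inter> Ss ! (Suc i mod length ps) = {ps ! (Suc i mod length ps)}) \<and>
     (\<forall>i<length ps. \<forall>j<length ps.
        i \<noteq> j \<and> j \<noteq> Suc i mod length ps \<and> i \<noteq> Suc j mod length ps \<longrightarrow> Ss ! i \<inter> Ss ! j = {}) \<and>
     (\<exists>h. homeomorphic_map (top_of_set (cball (0 :: complex) 1))
            (subtopology (Metric_space.mtopology X d) T) h \<and>
          h ` sphere 0 1 = \<Union> (set Ss))"

definition polygon_interior :: "'a set list \<Rightarrow> 'a set \<Rightarrow> 'a set" where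
  "polygon_interior Ss T = T - \<Union> (set Ss)"

definition perimeter :: "('a \<Rightarrow> 'a \<Rightarrow> real) \<Rightarrow> 'a list \<Rightarrow> real" where
  "perimeter d ps = (\<Sum>i<length ps. d (ps ! i) (ps ! (Suc i mod length ps)))"


section \<open>Convex surfaces of bounded specific curvature\<close>

definition complete_convex_surface :: "point set \<Rightarrow> bool" where
  "complete_convex_surface M \<longleftrightarrow>
     (\<exists>B. compact B \<and> convex B \<and> interior B \<noteq> {} \<and> M = frontier B)"

text \<open>Area: two-dimensional Hausdorff (outer) measure, with the normalization that gives plane regions
  their usual area.\<close>
definition hausdorff2 :: "point set \<Rightarrow> ennreal" where
  "hausdorff2 A =
     (SUP \<delta> \<in> {0::real<..}.
        INF C \<in> {C :: nat \<Rightarrow> point set.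
                   A \<subseteq> (\<Union>n. C n) \<and> (\<forall>n. bounded (C n) \<and> diameter (C n) \<le> \<delta>)}.
          (\<Sum>n. ennreal (pi / 4 * (diameter (C n))\<^sup>2)))"

definition surface_measure :: "point measure" where
  "surface_measure = measure_of UNIV (sets borel) hausdorff2"

text \<open>Outer unit normals of the support planes of \<open>M\<close> at the points of \<open>W\<close>.\<close>
definition spherical_image :: "point set \<Rightarrow> point set \<Rightarrow> point set" where
  "spherical_image M W = {n. norm n = 1 \<and> (\<exists>x\<in>W. \<forall>y\<in>M. n \<bullet> y \<le> n \<bullet> x)}"

definition total_curvature :: "(point \<Rightarrow> real) \<Rightarrow> point set \<Rightarrow> ennreal" where
  "total_curvature K W = (\<integral>\<^sup>+x\<in>W. ennreal (K x) \<partial>surface_measure)"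

text \<open>Gaussian curvature in Gauss's sense, as the density of the area of the spherical image with respect to
  the area of the surface. On surfaces of class \<open>C\<^sup>2\<close> this is the usual curvature; no smoothness of the
  convex surface is presupposed.\<close>
definition gaussian_curvature :: "point set \<Rightarrow> (point \<Rightarrow> real) \<Rightarrow> bool" where
  "gaussian_curvature M K \<longleftrightarrow>
     K \<in> borel_measurable borel \<and> (\<forall>x\<in>M. 0 \<le> K x) \<and>
     (\<forall>W \<in> sets borel. W \<subseteq> M \<longrightarrow> hausdorff2 (spherical_image M W) = total_curvature K W)"

definition specific_curvature :: "(point \<Rightarrow> real) \<Rightarrow> point set \<Rightarrow> real" where
  "specific_curvature K W = enn2real (total_curvature K W) / enn2real (hausdorff2 W)"

definition surface_domain :: "point set \<Rightarrow> point set \<Rightarrow> bool" where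
  "surface_domain M W \<longleftrightarrow> openin (top_of_set M) W \<and> connected W \<and> W \<noteq> {}"

definition bounded_specific_curvature :: "point set \<Rightarrow> real \<Rightarrow> real \<Rightarrow> bool" where
  "bounded_specific_curvature M K1 K2 \<longleftrightarrow>
     (\<exists>K. gaussian_curvature M K \<and>
        (\<forall>W. surface_domain M W \<longrightarrow> K1 < specific_curvature K W \<and> specific_curvature K W < K2))"

definition model_sphere :: "real \<Rightarrow> point set" where
  "model_sphere \<kappa> = sphere 0 (1 / sqrt \<kappa>)"


section \<open>Triangles and their angles\<close>

text \<open>A triangle with a distinguished vertex \<open>apex\<close> (which will be glued to \<open>P\<^sub>F\<close>).
  The side \<open>lside\<close> joins \<open>apex\<close> and \<open>lvert\<close>, \<open>base\<close> joins \<open>lvert\<close> and \<open>rvert\<close>,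
  \<open>rside\<close> joins \<open>rvert\<close> and \<open>apex\<close>.\<close>
record tri =
  region :: "point set"
  apex :: point
  lvert :: point
  rvert :: point
  lside :: "point set"
  base :: "point set"
  rside :: "point set"

definition triangle_on :: "point set \<Rightarrow> tri \<Rightarrow> bool" where
  "triangle_on X t \<longleftrightarrow>
     geodesic_polygon X (idist X) [apex t, lvert t, rvert t] [lside t, base t, rside t] (region t)"

text \<open>Convexity singles out the ordinary spherical triangle among the two regions bounded by its sides.\<close>
definition comparison_triangle :: "point set \<Rightarrow> tri \<Rightarrow> real \<Rightarrow> tri \<Rightarrow> bool" where
  "comparison_triangle M m \<kappa> t \<longleftrightarrow>
     triangle_on (model_sphere \<kappa>) t \<and>
     geodesically_convex (model_sphere \<kappa>) (idist (model_sphere \<kappa>)) (region t) \<and>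
     idist (model_sphere \<kappa>) (apex t) (lvert t) = idist M (apex m) (lvert m) \<and>
     idist (model_sphere \<kappa>) (lvert t) (rvert t) = idist M (lvert m) (rvert m) \<and>
     idist (model_sphere \<kappa>) (rvert t) (apex t) = idist M (rvert m) (apex m)"

text \<open>Alexandrov's (upper) angle between the two sides at \<open>apex t\<close>: the upper limit, for points \<open>x\<close>, \<open>y\<close> of
  the sides tending to the vertex, of the angle in the Euclidean triangle with the same three distances.
  Distances are measured inside the triangle, because only its inner metric enters the gluing; for a
  geodesically convex triangle they are the distances on the surface.\<close>
definition tri_angle :: "tri \<Rightarrow> real" where
  "tri_angle t =
     (let d = idist (region t); p = apex t in
      real_of_ereal (Limsup ((at p within lside t) \<times>\<^sub>F (at p within rside t))
        (\<lambda>(x, y). ereal (arccos (((d p x)\<^sup>2 + (d p y)\<^sup>2 - (d x y)\<^sup>2) / (2 * d p x * d p y))))))"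


section \<open>Gluing four triangles around a vertex\<close>

text \<open>\<open>nxt\<close> follows the order of the triangles \<open>AP\<^sub>FD\<close>, \<open>DP\<^sub>FC\<close>, \<open>CP\<^sub>FB\<close>, \<open>BP\<^sub>FA\<close> around \<open>P\<^sub>F\<close>.
  The triangle with index \<open>R\<close> has \<open>lvert\<close> at \<open>R\<close> and \<open>rvert\<close> at \<open>nxt R\<close>.\<close>
datatype vertex = vA | vB | vC | vD

fun nxt :: "vertex \<Rightarrow> vertex" where
  "nxt vA = vD" | "nxt vD = vC" | "nxt vC = vB" | "nxt vB = vA"

definition vertices :: "vertex set" where
  "vertices = {vA, vB, vC, vD}"

definition glue_points :: "(vertex \<Rightarrow> tri) \<Rightarrow> (vertex \<times> point) set" where
  "glue_points t = (SIGMA k:vertices. region (t k))"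

text \<open>The common side \<open>P\<^sub>FR\<close> of two neighbouring triangles is glued by length, starting at \<open>P\<^sub>F\<close>.\<close>
definition side_identification :: "(vertex \<Rightarrow> tri) \<Rightarrow> ((vertex \<times> point) \<times> (vertex \<times> point)) set" where
  "side_identification t =
     {((k, x), (nxt k, y)) | k x y.
        x \<in> rside (t k) \<and> y \<in> lside (t (nxt k)) \<and>
        inner_dist (region (t k)) (apex (t k)) x =
          inner_dist (region (t (nxt k))) (apex (t (nxt k))) y}"

definition glue_rel :: "(vertex \<Rightarrow> tri) \<Rightarrow> ((vertex \<times> point) \<times> (vertex \<times> point)) set" where
  "glue_rel t = (side_identification t \<union> (side_identification t)\<inverse>)\<^sup>*"

definition glued :: "(vertex \<Rightarrow> tri) \<Rightarrow> (vertex \<times> point) set set" where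
  "glued t = glue_points t // glue_rel t"

definition gclass :: "(vertex \<Rightarrow> tri) \<Rightarrow> vertex \<Rightarrow> point \<Rightarrow> (vertex \<times> point) set" where
  "gclass t k x = glue_rel t `` {(k, x)}"

definition gP :: "(vertex \<Rightarrow> tri) \<Rightarrow> (vertex \<times> point) set" where
  "gP t = gclass t vA (apex (t vA))"

definition gvert :: "(vertex \<Rightarrow> tri) \<Rightarrow> vertex \<Rightarrow> (vertex \<times> point) set" where
  "gvert t R = gclass t R (lvert (t R))"

text \<open>The metric of the glued manifold is the quotient metric: the infimum of the total length of chains of
  steps \<open>(k, x, y)\<close>, each going from \<open>x\<close> to \<open>y\<close> inside the triangle \<open>k\<close>, such that the end of each step
  is identified with the beginning of the next one.\<close>
definition glue_chain ::
  "(vertex \<Rightarrow> tri) \<Rightarrow> (vertex \<times> point) set \<Rightarrow> (vertex \<times> point) set \<Rightarrow> (vertex \<times> point \<times> point) list \<Rightarrow> bool" where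
  "glue_chain t p q cs \<longleftrightarrow>
     cs \<noteq> [] \<and>
     (\<forall>(k, x, y) \<in> set cs. x \<in> region (t k) \<and> y \<in> region (t k)) \<and>
     (case hd cs of (k, x, y) \<Rightarrow> (k, x) \<in> p) \<and>
     (case last cs of (k, x, y) \<Rightarrow> (k, y) \<in> q) \<and>
     (\<forall>i. Suc i < length cs \<longrightarrow>
        (case (cs ! i, cs ! Suc i) of ((k, x, y), (k', x', y')) \<Rightarrow> ((k, y), (k', x')) \<in> glue_rel t))"

definition gdist :: "(vertex \<Rightarrow> tri) \<Rightarrow> (vertex \<times> point) set \<Rightarrow> (vertex \<times> point) set \<Rightarrow> real" where
  "gdist t p q =
     enn2real (INF cs \<in> {cs. glue_chain t p q cs}. \<Sum>(k, x, y) \<leftarrow> cs. inner_dist (region (t k)) x y)"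

text \<open>The directions of the arcs \<open>P\<^sub>FR\<close> in the plane of directions at \<open>P\<^sub>F\<close>, normalized so that the
  direction of \<open>P\<^sub>FA\<close> is \<open>1\<close>.\<close>
fun direction :: "(vertex \<Rightarrow> tri) \<Rightarrow> vertex \<Rightarrow> complex" where
  "direction t vA = 1"
| "direction t vD = cis (tri_angle (t vA))"
| "direction t vC = cis (tri_angle (t vA) + tri_angle (t vD))"
| "direction t vB = cis (tri_angle (t vA) + tri_angle (t vD) + tri_angle (t vC))"

definition full_angle :: "(vertex \<Rightarrow> tri) \<Rightarrow> bool" where
  "full_angle t \<longleftrightarrow> (\<Sum>k\<in>vertices. tri_angle (t k)) = 2 * pi"


section \<open>The glued manifolds\<close>

text \<open>The triangles \<open>m k\<close> on \<open>M\<close> with common vertex \<open>P\<^sub>F\<close> subdivide a convex quadrilateral \<open>ABCD\<close> that has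
  \<open>P\<^sub>F\<close> in its interior.\<close>
definition subdivided_quadrilateral :: "point set \<Rightarrow> real \<Rightarrow> (vertex \<Rightarrow> tri) \<Rightarrow> bool" where
  "subdivided_quadrilateral M K1 m \<longleftrightarrow>
     (\<forall>k. triangle_on M (m k)) \<and>
     (\<forall>k. apex (m (nxt k)) = apex (m k) \<and> lvert (m (nxt k)) = rvert (m k) \<and>
          lside (m (nxt k)) = rside (m k)) \<and>
     (\<forall>j k. j \<noteq> k \<longrightarrow>
        polygon_interior [lside (m j), base (m j), rside (m j)] (region (m j)) \<inter>
        polygon_interior [lside (m k), base (m k), rside (m k)] (region (m k)) = {}) \<and>
     (let ps = [lvert (m vA), lvert (m vD), lvert (m vC), lvert (m vB)];
          Ss = [base (m vA), base (m vD), base (m vC), base (m vB)];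
          Q = (\<Union>k\<in>vertices. region (m k))
      in geodesic_polygon M (idist M) ps Ss Q \<and> geodesically_convex M (idist M) Q \<and>
         perimeter (idist M) ps < 2 * pi / sqrt K1 \<and>
         apex (m vA) \<in> polygon_interior Ss Q)"

definition glued_one_prime ::
  "point set \<Rightarrow> real \<Rightarrow> real \<Rightarrow> (vertex \<Rightarrow> tri) \<Rightarrow> (vertex \<Rightarrow> tri) \<Rightarrow> bool" where
  "glued_one_prime M K1 K2 m t \<longleftrightarrow>
     subdivided_quadrilateral M K1 m \<and>
     comparison_triangle M (m vA) K1 (t vA) \<and> comparison_triangle M (m vD) K1 (t vD) \<and>
     comparison_triangle M (m vC) K2 (t vC) \<and> comparison_triangle M (m vB) K2 (t vB) \<and>
     full_angle t"

definition glued_two_prime ::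
  "point set \<Rightarrow> real \<Rightarrow> real \<Rightarrow> (vertex \<Rightarrow> tri) \<Rightarrow> (vertex \<Rightarrow> tri) \<Rightarrow> bool" where
  "glued_two_prime M K1 K2 m t \<longleftrightarrow>
     subdivided_quadrilateral M K1 m \<and>
     t vA = m vA \<and> t vD = m vD \<and>
     comparison_triangle M (m vC) K1 (t vC) \<and> comparison_triangle M (m vB) K2 (t vB) \<and>
     full_angle t"

definition P_interior_triangle :: "(vertex \<Rightarrow> tri) \<Rightarrow> vertex \<Rightarrow> vertex \<Rightarrow> vertex \<Rightarrow> bool" where
  "P_interior_triangle t R S L \<longleftrightarrow>
     (\<exists>Ss T. geodesic_polygon (glued t) (gdist t) [gvert t R, gvert t S, gvert t L] Ss T \<and>
             gP t \<in> polygon_interior Ss T)"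


section \<open>Inverse weighted Fermat-Torricelli problems\<close>

definition FT_objective :: "(vertex \<Rightarrow> tri) \<Rightarrow> (vertex \<Rightarrow> real) \<Rightarrow> (vertex \<times> point) set \<Rightarrow> real" where
  "FT_objective t w P = (\<Sum>R\<in>vertices. w R * gdist t P (gvert t R))"

definition inverse_FT4 :: "(vertex \<Rightarrow> tri) \<Rightarrow> real \<Rightarrow> (vertex \<Rightarrow> real) \<Rightarrow> bool" where
  "inverse_FT4 t c w \<longleftrightarrow>
     (\<forall>R\<in>vertices. 0 < w R) \<and> (\<Sum>R\<in>vertices. w R) = c \<and>
     (\<forall>P\<in>glued t. FT_objective t w (gP t) \<le> FT_objective t w P)"

definition inverse_FT3 :: "(vertex \<Rightarrow> tri) \<Rightarrow> real \<Rightarrow> vertex set \<Rightarrow> (vertex \<Rightarrow> real) \<Rightarrow> bool" where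
  "inverse_FT3 t c V w \<longleftrightarrow>
     (\<Sum>R\<in>V. w R) = c \<and> (\<Sum>R\<in>V. w R *\<^sub>R direction t R) = 0"

end

theory Submission
  imports Defs
begin

text \<open>The weights of a solution balance: if \<open>u\<^sub>R\<close> is the direction of the arc from \<open>P\<^sub>F\<close> to \<open>R\<close> in the
  plane of directions, then the sum of the \<open>w\<^sub>R u\<^sub>R\<close> is \<open>0\<close>. Multiplying this relation and the relations
  that define the solutions of the 3-inverse problems for \<open>ABC\<close> and \<open>ACD\<close> with \<open>u\<^sub>C\<close> by the cross
  product leaves three equations in which \<open>w\<^sub>C\<close> no longer occurs, and the first ratio follows; the second one follows in the
  same way with \<open>u\<^sub>B\<close> and the problems for \<open>ABC\<close> and \<open>ABD\<close> (\<open>weight_ratio\<close>).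

  The balance (\<open>FT4_balance\<close>) rests on upper bounds for distances. Let \<open>W\<close> be the sum of the
  \<open>w\<^sub>R u\<^sub>R\<close>. When \<open>P\<close> moves away from \<open>P\<^sub>F\<close> along the arc to \<open>R\<close>, its distance from \<open>S\<close>
  decreases at least at the rate \<open>u\<^sub>R \<bullet> u\<^sub>S\<close>, so minimality at \<open>P\<^sub>F\<close> gives \<open>u\<^sub>R \<bullet> W \<le> 0\<close>.
  As \<open>W\<close> is a positive combination of the \<open>u\<^sub>R\<close>, this implies \<open>W \<bullet> W \<le> 0\<close>. The decrease is
  read off from explicit paths (\<open>descends_direction\<close>): for adjacent sides the definition of the angle as
  an upper limit provides them, and for opposite sides they cross the side between them at the point
  where a Euclidean segment would do so. One exact distance enters, that of
  \<open>P\<^sub>F\<close> from the vertices (\<open>gdist_gP_gvert\<close>): the distance to the apex in the triangles is a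
  \<open>1\<close>-Lipschitz function that the gluing respects.

  The elimination fails only if all four directions lie on one line. Then all four angles at \<open>P\<^sub>F\<close> are
  \<open>0\<close> or \<open>\<pi>\<close>. The triangles \<open>CP\<^sub>FB\<close> and \<open>BP\<^sub>FA\<close> are spherical in both manifolds, and the angle of a
  spherical triangle is positive because great circle arcs do not branch
  (\<open>spherical_triangle_angle_pos\<close>). So these two angles are \<open>\<pi>\<close>, the other two are \<open>0\<close>, and the directions
  to \<open>A\<close>, \<open>D\<close> and \<open>C\<close> coincide, which is impossible for balancing weights on \<open>A\<close>, \<open>C\<close>, \<open>D\<close> with
  positive sum (\<open>directions_not_collinear\<close>).\<close>

section \<open>The inner metric of a set\<close>

lemma curve_length_leI:
  assumes "\<And>n \<tau>. mono \<tau> \<Longrightarrow> range \<tau> \<subseteq> {0..1} \<Longrightarrow>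
             (\<Sum>i<n. ennreal (dist (g (\<tau> i)) (g (\<tau> (Suc i))))) \<le> B"
  shows "curve_length g \<le> B"
  unfolding curve_length_def by (rule SUP_least) (auto intro: assms simp del: sum_ennreal)

lemma polygon_le_curve_length:
  assumes "mono \<tau>" and "range \<tau> \<subseteq> {0..1}"
  shows "(\<Sum>i<n. ennreal (dist (g (\<tau> i)) (g (\<tau> (Suc i))))) \<le> curve_length g"
  unfolding curve_length_def by (rule SUP_upper2[where i="(n, \<tau>)"]) (use assms in auto)

lemma curve_length_lipschitz:
  assumes "0 \<le> L"
    and lip: "\<And>u v. u \<in> {0..1} \<Longrightarrow> v \<in> {0..1} \<Longrightarrow> dist (g u) (g v) \<le> L * \<bar>u - v\<bar>"
  shows "curve_length g \<le> ennreal L"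
proof (rule curve_length_leI)
  fix n :: nat and \<tau> :: "nat \<Rightarrow> real"
  assume mono: "mono \<tau>" and rng: "range \<tau> \<subseteq> {0..1}"
  have \<tau>: "\<tau> i \<in> {0..1}" for i
    using rng by blast
  have "(\<Sum>i<n. ennreal (dist (g (\<tau> i)) (g (\<tau> (Suc i)))))
      = ennreal (\<Sum>i<n. dist (g (\<tau> i)) (g (\<tau> (Suc i))))"
    by (simp add: sum_ennreal)
  also have "(\<Sum>i<n. dist (g (\<tau> i)) (g (\<tau> (Suc i)))) \<le> (\<Sum>i<n. L * (\<tau> (Suc i) - \<tau> i))"
  proof (rule sum_mono)
    fix i
    have "\<tau> i \<le> \<tau> (Suc i)"
      using mono by (simp add: monoD)
    then show "dist (g (\<tau> i)) (g (\<tau> (Suc i))) \<le> L * (\<tau> (Suc i) - \<tau> i)"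
      using lip[OF \<tau>[of i] \<tau>[of "Suc i"]] by simp
  qed
  also have "\<dots> = L * (\<tau> n - \<tau> 0)"
    by (simp add: sum_distrib_left[symmetric] sum_lessThan_telescope)
  also have "\<dots> \<le> L"
    using \<tau>[of n] \<tau>[of 0] \<open>0 \<le> L\<close> mult_left_mono[of "\<tau> n - \<tau> 0" 1 L] by auto
  finally show "(\<Sum>i<n. ennreal (dist (g (\<tau> i)) (g (\<tau> (Suc i))))) \<le> ennreal L"
    by (simp add: ennreal_leI)
qed

lemma inner_dist_le_curve_length:
  assumes "path g" and "path_image g \<subseteq> X" and "pathstart g = x" and "pathfinish g = y"
  shows "inner_dist X x y \<le> curve_length g"
  unfolding inner_dist_def using assms by (intro INF_lower) auto

lemma inner_dist_greatest:
  assumes "\<And>g. \<lbrakk>path g; path_image g \<subseteq> X; pathstart g = x; pathfinish g = y\<rbrakk> \<Longrightarrow> B \<le> curve_length g"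
  shows "B \<le> inner_dist X x y"
  unfolding inner_dist_def using assms by (intro INF_greatest) auto

lemma idist_nonneg: "0 \<le> idist X x y"
  by (simp add: idist_def)

lemma inner_dist_antimono: "T \<subseteq> X \<Longrightarrow> inner_dist X x y \<le> inner_dist T x y"
  by (rule inner_dist_greatest) (blast intro: inner_dist_le_curve_length)

lemma inner_dist_lipschitz:
  assumes "0 \<le> L"
    and lip: "\<And>u v. u \<in> {0..1} \<Longrightarrow> v \<in> {0..1} \<Longrightarrow> dist (g u) (g v) \<le> L * \<bar>u - v\<bar>"
    and "g ` {0..1} \<subseteq> X" and "g 0 = x" and "g 1 = y"
  shows "inner_dist X x y \<le> ennreal L"
proof -
  have "L-lipschitz_on {0..1} g"
    using assms(1) lip by (intro lipschitz_onI) (auto simp: dist_real_def)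
  then have "path g"
    unfolding path_def by (rule lipschitz_on_continuous_on)
  then have "inner_dist X x y \<le> curve_length g"
    using assms(3-5) by (intro inner_dist_le_curve_length)
      (auto simp: path_image_def pathstart_def pathfinish_def)
  also have "\<dots> \<le> ennreal L"
    using assms(1) lip by (rule curve_length_lipschitz)
  finally show ?thesis .
qed

lemma dist_le_inner_dist: "ennreal (dist x y) \<le> inner_dist X x y"
proof (rule inner_dist_greatest)
  fix g assume g: "path g" "path_image g \<subseteq> X" "pathstart g = x" "pathfinish g = y"
  have "(\<Sum>i<1. ennreal (dist (g (min 1 (real i))) (g (min 1 (real (Suc i)))))) \<le> curve_length g"
    by (rule polygon_le_curve_length[where \<tau>="\<lambda>i. min 1 (real i)"]) (auto simp: mono_def)
  then show "ennreal (dist x y) \<le> curve_length g"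
    using g by (simp add: pathstart_def pathfinish_def)
qed

lemma inner_dist_refl:
  assumes "x \<in> X"
  shows "inner_dist X x x = 0"
proof -
  have "inner_dist X x x \<le> ennreal 0"
    by (rule inner_dist_lipschitz[where g="\<lambda>_. x"]) (use assms in auto)
  then show ?thesis by simp
qed

lemma curve_length_reversepath: "curve_length (reversepath g) \<le> curve_length g"
proof (rule curve_length_leI)
  fix n :: nat and \<tau> :: "nat \<Rightarrow> real"
  assume mono: "mono \<tau>" and rng: "range \<tau> \<subseteq> {0..1}"
  let ?\<sigma> = "\<lambda>i. 1 - \<tau> (n - i)"
  have "(\<Sum>i<n. ennreal (dist (reversepath g (\<tau> i)) (reversepath g (\<tau> (Suc i)))))
      = (\<Sum>i<n. ennreal (dist (g (1 - \<tau> (n - Suc i))) (g (1 - \<tau> (Suc (n - Suc i))))))"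
    unfolding reversepath_def by (subst sum.nat_diff_reindex[symmetric]) simp
  also have "\<dots> = (\<Sum>i<n. ennreal (dist (g (?\<sigma> i)) (g (?\<sigma> (Suc i)))))"
    by (intro sum.cong) (auto simp: dist_commute Suc_diff_Suc)
  also have "\<dots> \<le> curve_length g"
  proof (rule polygon_le_curve_length)
    show "mono ?\<sigma>"
      using mono by (auto simp: mono_def)
    show "range ?\<sigma> \<subseteq> {0..1}"
      using rng by (force simp: image_subset_iff)
  qed
  finally show "(\<Sum>i<n. ennreal (dist (reversepath g (\<tau> i)) (reversepath g (\<tau> (Suc i))))) \<le> curve_length g" .
qed

lemma inner_dist_commute: "inner_dist X x y = inner_dist X y x"
proof -
  have "inner_dist X a b \<le> inner_dist X b a" for a b
  proof (rule inner_dist_greatest)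
    fix g assume g: "path g" "path_image g \<subseteq> X" "pathstart g = b" "pathfinish g = a"
    have "inner_dist X a b \<le> curve_length (reversepath g)"
      by (rule inner_dist_le_curve_length) (use g in auto)
    also note curve_length_reversepath
    finally show "inner_dist X a b \<le> curve_length g" .
  qed
  then show ?thesis
    by (intro antisym)
qed

lemma curve_length_join:
  assumes "pathfinish g = pathstart h"
  shows "curve_length (g +++ h) \<le> curve_length g + curve_length h"
proof (rule curve_length_leI)
  fix n :: nat and \<tau> :: "nat \<Rightarrow> real"
  assume mono: "mono \<tau>" and rng: "range \<tau> \<subseteq> {0..1}"
  \<comment> \<open>Clamping a partition to the two halves: the step across the junction is split there,
    and all other steps of one half are constant on the other.\<close>
  define \<sigma> where "\<sigma> = (\<lambda>i. min 1 (2 * \<tau> i))"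
  define \<rho> where "\<rho> = (\<lambda>i. max 0 (2 * \<tau> i - 1))"
  have step: "dist ((g +++ h) (\<tau> i)) ((g +++ h) (\<tau> (Suc i)))
      \<le> dist (g (\<sigma> i)) (g (\<sigma> (Suc i))) + dist (h (\<rho> i)) (h (\<rho> (Suc i)))" for i
  proof -
    have le: "\<tau> i \<le> \<tau> (Suc i)"
      using mono by (simp add: monoD)
    have gh: "g 1 = h 0"
      using assms by (simp add: pathstart_def pathfinish_def)
    consider "\<tau> (Suc i) \<le> 1/2" | "\<tau> i \<le> 1/2" "1/2 < \<tau> (Suc i)" | "1/2 < \<tau> i"
      by linarith
    then show ?thesis
    proof cases
      case 1
      then show ?thesis using le by (simp add: joinpaths_def \<sigma>_def \<rho>_def)
    next
      case 2
      then have "\<sigma> (Suc i) = 1" "\<rho> i = 0" "\<sigma> i = 2 * \<tau> i" "\<rho> (Suc i) = 2 * \<tau> (Suc i) - 1"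
        by (auto simp: \<sigma>_def \<rho>_def)
      then show ?thesis
        using 2 gh dist_triangle[of "g (\<sigma> i)" "h (\<rho> (Suc i))" "h 0"] by (simp add: joinpaths_def)
    next
      case 3
      then show ?thesis using le by (simp add: joinpaths_def \<sigma>_def \<rho>_def)
    qed
  qed
  have \<tau>: "0 \<le> \<tau> i" "\<tau> i \<le> 1" for i
    using rng by (auto simp: image_subset_iff)
  have "(\<Sum>i<n. ennreal (dist ((g +++ h) (\<tau> i)) ((g +++ h) (\<tau> (Suc i)))))
      \<le> (\<Sum>i<n. ennreal (dist (g (\<sigma> i)) (g (\<sigma> (Suc i)))) + ennreal (dist (h (\<rho> i)) (h (\<rho> (Suc i)))))"
    by (rule sum_mono) (metis ennreal_leI ennreal_plus step zero_le_dist)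
  also have "\<dots> = (\<Sum>i<n. ennreal (dist (g (\<sigma> i)) (g (\<sigma> (Suc i)))))
      + (\<Sum>i<n. ennreal (dist (h (\<rho> i)) (h (\<rho> (Suc i)))))"
    by (rule sum.distrib)
  also have "\<dots> \<le> curve_length g + curve_length h"
  proof (intro add_mono polygon_le_curve_length)
    show "mono \<sigma>" "mono \<rho>"
      using mono unfolding \<sigma>_def \<rho>_def mono_def by (fastforce simp: min_def max_def)+
    show "range \<sigma> \<subseteq> {0..1}" "range \<rho> \<subseteq> {0..1}"
      using \<tau> by (auto simp: \<sigma>_def \<rho>_def)
  qed
  finally show "(\<Sum>i<n. ennreal (dist ((g +++ h) (\<tau> i)) ((g +++ h) (\<tau> (Suc i)))))
      \<le> curve_length g + curve_length h" .
qed

lemma inner_dist_triangle: "inner_dist X x z \<le> inner_dist X x y + inner_dist X y z"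
proof (rule ennreal_le_epsilon)
  fix e :: real
  assume fin: "inner_dist X x y + inner_dist X y z < top" and "0 < e"
  have "inner_dist X x y < inner_dist X x y + ennreal (e/2)"
    using fin \<open>0 < e\<close> by (auto simp: ennreal_add_less_top less_top)
  then obtain g where g: "path g" "path_image g \<subseteq> X" "pathstart g = x" "pathfinish g = y"
    and gl: "curve_length g < inner_dist X x y + ennreal (e/2)"
    unfolding inner_dist_def[of X x y] INF_less_iff by blast
  have "inner_dist X y z < inner_dist X y z + ennreal (e/2)"
    using fin \<open>0 < e\<close> by (auto simp: ennreal_add_less_top less_top)
  then obtain h where h: "path h" "path_image h \<subseteq> X" "pathstart h = y" "pathfinish h = z"
    and hl: "curve_length h < inner_dist X y z + ennreal (e/2)"
    unfolding inner_dist_def[of X y z] INF_less_iff by blast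
  have "inner_dist X x z \<le> curve_length (g +++ h)"
    by (rule inner_dist_le_curve_length) (use g h in \<open>auto simp: path_image_join\<close>)
  also have "\<dots> \<le> curve_length g + curve_length h"
    by (rule curve_length_join) (use g h in auto)
  also have "\<dots> \<le> (inner_dist X x y + ennreal (e/2)) + (inner_dist X y z + ennreal (e/2))"
    using gl hl by (intro add_mono) auto
  also have "\<dots> = inner_dist X x y + inner_dist X y z + (ennreal (e/2) + ennreal (e/2))"
    by (simp add: ac_simps)
  also have "ennreal (e/2) + ennreal (e/2) = ennreal e"
    using \<open>0 < e\<close> by (simp flip: ennreal_plus)
  finally show "inner_dist X x z \<le> inner_dist X x y + inner_dist X y z + ennreal e" .
qed

definition unit_speed :: "point set \<Rightarrow> real \<Rightarrow> (real \<Rightarrow> point) \<Rightarrow> bool" where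
  "unit_speed T L g \<longleftrightarrow> g ` {0..L} \<subseteq> T \<and>
     (\<forall>s\<in>{0..L}. \<forall>t\<in>{0..L}. inner_dist T (g s) (g t) = ennreal \<bar>s - t\<bar>)"

lemma unit_speed_dist:
  assumes "unit_speed T L g" and "s \<in> {0..L}" and "t \<in> {0..L}"
  shows "inner_dist T (g s) (g t) = ennreal \<bar>s - t\<bar>"
  using assms by (simp add: unit_speed_def)

text \<open>A shortest arc is parametrized by a curve that is \<open>1\<close>-Lipschitz in space, so it has the same length
  in every set \<open>T\<close> that contains it. Hence the sides of a triangle have the same inner geometry in the
  triangle as on the surface.\<close>
lemma shortest_arc_unit_speed:
  assumes "shortest_arc X (idist X) S x y"
  obtains g where "g 0 = x" "g (idist X x y) = y" "g ` {0..idist X x y} = S"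
    "\<And>T. S \<subseteq> T \<Longrightarrow> T \<subseteq> X \<Longrightarrow> unit_speed T (idist X x y) g"
proof -
  obtain L g where "0 \<le> L" and S: "g ` {0..L} = S" "S \<subseteq> X" and g: "g 0 = x" "g L = y"
    and iso: "\<And>s t. s \<in> {0..L} \<Longrightarrow> t \<in> {0..L} \<Longrightarrow> idist X (g s) (g t) = \<bar>s - t\<bar>"
    using assms unfolding shortest_arc_def by blast
  have L: "idist X x y = L"
    using iso[of 0 L] g \<open>0 \<le> L\<close> by simp
  have X: "inner_dist X (g s) (g t) = ennreal \<bar>s - t\<bar>" if st: "s \<in> {0..L}" "t \<in> {0..L}" for s t
  proof (cases "s = t")
    case True
    moreover have "g s \<in> X"
      using S st by blast
    ultimately show ?thesis using inner_dist_refl[of "g s" X] by simp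
  next
    case False
    \<comment> \<open>A positive real value rules out that the distance is infinite.\<close>
    then have "0 < enn2real (inner_dist X (g s) (g t))"
      using iso[OF st] by (simp add: idist_def)
    then show ?thesis
      using iso[OF st] by (metis enn2real_positive_iff ennreal_enn2real idist_def)
  qed
  have lip: "dist (g s) (g t) \<le> \<bar>s - t\<bar>" if "s \<in> {0..L}" "t \<in> {0..L}" for s t
    using dist_le_inner_dist[of "g s" "g t" X] X[OF that] by simp
  have T: "inner_dist T (g s) (g t) = ennreal \<bar>s - t\<bar>"
    if T: "S \<subseteq> T" "T \<subseteq> X" and st: "s \<in> {0..L}" "t \<in> {0..L}" for T s t
  proof (rule antisym)
    have seg: "s + u * (t - s) \<in> {0..L}" if "u \<in> {0..1}" for u
    proof -
      have "s + u * (t - s) = (1 - u) * s + u * t" by algebra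
      moreover have "0 \<le> (1 - u) * s" "0 \<le> u * t" "(1 - u) * s \<le> (1 - u) * L" "u * t \<le> u * L"
        using that st by (auto intro: mult_left_mono)
      moreover have "(1 - u) * L + u * L = L" by (simp add: algebra_simps)
      ultimately show ?thesis by simp
    qed
    show "inner_dist T (g s) (g t) \<le> ennreal \<bar>s - t\<bar>"
    proof (rule inner_dist_lipschitz[where g="\<lambda>u. g (s + u * (t - s))"])
      fix u v :: real assume uv: "u \<in> {0..1}" "v \<in> {0..1}"
      have "dist (g (s + u * (t - s))) (g (s + v * (t - s))) \<le> \<bar>(u - v) * (t - s)\<bar>"
        using lip[OF seg[OF uv(1)] seg[OF uv(2)]] by (simp add: algebra_simps)
      then show "dist (g (s + u * (t - s))) (g (s + v * (t - s))) \<le> \<bar>s - t\<bar> * \<bar>u - v\<bar>"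
        by (simp add: abs_mult abs_minus_commute mult.commute)
    qed (use seg S T in \<open>auto\<close>)
    show "ennreal \<bar>s - t\<bar> \<le> inner_dist T (g s) (g t)"
      using inner_dist_antimono[OF T(2)] X[OF st] by metis
  qed
  show thesis
    by (rule that[of g]) (use L S g T in \<open>auto simp: unit_speed_def\<close>)
qed

section \<open>Shortest arcs on a round sphere\<close>

lemma derivative_one_at_zero:
  fixes f :: "real \<Rightarrow> real"
  assumes "(f has_field_derivative 1) (at 0)" and "f 0 = 0" and "0 < e"
  obtains d where "0 < d" and "\<And>x. \<bar>x\<bar> < d \<Longrightarrow> \<bar>f x - x\<bar> \<le> e * \<bar>x\<bar>"
proof -
  have "(f has_derivative (*) 1) (at 0)"
    using assms(1) by (simp add: has_field_derivative_def)
  then show thesis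
    using assms(2,3) that unfolding has_derivative_at_alt by fastforce
qed

lemma arccos_inner_triangle:
  fixes x y z :: "'a::real_inner"
  assumes "norm x = 1" "norm y = 1" "norm z = 1"
  shows "arccos (x \<bullet> z) \<le> arccos (x \<bullet> y) + arccos (y \<bullet> z)"
proof -
  have bnd: "\<bar>u \<bullet> v\<bar> \<le> 1" if "norm u = 1" "norm v = 1" for u v :: 'a
    using Cauchy_Schwarz_ineq2[of u v] that by simp
  define a where "a = x \<bullet> y"
  define b where "b = y \<bullet> z"
  have a: "-1 \<le> a" "a \<le> 1" and b: "-1 \<le> b" "b \<le> 1" and xz: "-1 \<le> x \<bullet> z" "x \<bullet> z \<le> 1"
    using bnd[of x y] bnd[of y z] bnd[of x z] assms by (auto simp: a_def b_def abs_le_iff)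
  show ?thesis
  proof (cases "arccos a + arccos b \<le> pi")
    case False
    then show ?thesis
      using arccos_ubound[OF xz] by (simp add: a_def b_def)
  next
    case True
    \<comment> \<open>Cauchy--Schwarz for the components of \<open>x\<close> and \<open>z\<close> orthogonal to \<open>y\<close>.\<close>
    have sq: "x \<bullet> x = 1" "y \<bullet> y = 1" "z \<bullet> z = 1"
      using assms by (simp_all add: dot_square_norm)
    have "\<bar>(x - a *\<^sub>R y) \<bullet> (z - b *\<^sub>R y)\<bar> \<le> norm (x - a *\<^sub>R y) * norm (z - b *\<^sub>R y)"
      by (rule Cauchy_Schwarz_ineq2)
    moreover have "(x - a *\<^sub>R y) \<bullet> (z - b *\<^sub>R y) = x \<bullet> z - a * b"
      by (simp add: inner_diff_left inner_diff_right sq a_def b_def inner_commute)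
    moreover have "norm (x - a *\<^sub>R y) = sqrt (1 - a\<^sup>2)" "norm (z - b *\<^sub>R y) = sqrt (1 - b\<^sup>2)"
      by (simp_all add: norm_eq_sqrt_inner inner_diff_left inner_diff_right sq a_def b_def
          inner_commute power2_eq_square)
    ultimately have "a * b - sqrt (1 - a\<^sup>2) * sqrt (1 - b\<^sup>2) \<le> x \<bullet> z"
      by (simp add: abs_le_iff)
    moreover have "cos (arccos a + arccos b) = a * b - sqrt (1 - a\<^sup>2) * sqrt (1 - b\<^sup>2)"
      using a b by (simp add: cos_add sin_arccos)
    ultimately have "arccos (x \<bullet> z) \<le> arccos (cos (arccos a + arccos b))"
      using xz cos_ge_minus_one[of "arccos a + arccos b"] by (intro arccos_le_arccos) linarith+
    also have "\<dots> = arccos a + arccos b"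
      using True arccos_lbound[OF a] arccos_lbound[OF b] by (intro arccos_cos) auto
    finally show ?thesis
      by (simp add: a_def b_def)
  qed
qed

lemma arccos_inner_chord:
  fixes x y :: "'a::real_inner"
  assumes "norm x = 1" "norm y = 1"
  shows "arccos (x \<bullet> y) = 2 * arcsin (dist x y / 2)"
proof -
  define q where "q = dist x y / 2"
  have q: "0 \<le> q" "q \<le> 1"
    using norm_triangle_ineq4[of x y] assms by (auto simp: q_def dist_norm)
  have sq: "x \<bullet> x = 1" "y \<bullet> y = 1"
    using assms by (simp_all add: dot_square_norm)
  have "(dist x y)\<^sup>2 = 2 - 2 * (x \<bullet> y)"
    by (simp add: dist_norm power2_norm_eq_inner inner_diff_left inner_diff_right sq
        inner_commute[of y x])
  then have "x \<bullet> y = 1 - 2 * q\<^sup>2"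
    by (simp add: q_def power_divide diff_divide_distrib)
  also have "\<dots> = cos (2 * arcsin q)"
    using q by (simp add: cos_double_sin)
  finally have "arccos (x \<bullet> y) = arccos (cos (2 * arcsin q))"
    by simp
  also have "\<dots> = 2 * arcsin q"
  proof (rule arccos_cos)
    show "0 \<le> 2 * arcsin q" "2 * arcsin q \<le> pi"
      using q arcsin_le_arcsin[of 0 q] arcsin_ubound[of q] by simp_all
  qed
  finally show ?thesis
    by (simp add: q_def)
qed

text \<open>Refining a partition makes its chords almost as long as the great circle arcs that they span,
  and by the triangle inequality for angles those arcs together are at least as long as the arc
  between the end points.\<close>
lemma curve_length_ge_great_circle:
  fixes g :: "real \<Rightarrow> point"
  assumes "0 < \<rho>" and "path g" and "path_image g \<subseteq> sphere 0 \<rho>"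
  shows "ennreal (\<rho> * arccos (pathstart g \<bullet> pathfinish g / \<rho>\<^sup>2)) \<le> curve_length g"
proof -
  define G where "G = (\<lambda>u. g u /\<^sub>R \<rho>)"
  have G1: "norm (G u) = 1" if "u \<in> {0..1}" for u
    using that assms(1,3) by (auto simp: G_def path_image_def image_subset_iff)
  have distG: "dist (g u) (g v) = \<rho> * dist (G u) (G v)" for u v
    using assms(1) by (simp add: G_def dist_norm flip: scaleR_diff_right)
  have innG: "G u \<bullet> G v = g u \<bullet> g v / \<rho>\<^sup>2" for u v
    using assms(1) by (simp add: G_def power2_eq_square field_simps)
  have bound: "ennreal (\<rho> * arccos (G 0 \<bullet> G 1)) \<le> ennreal (1 + e) * curve_length g" if "0 < e" for e
  proof -
    have "(arcsin has_field_derivative inverse (sqrt (1 - 0\<^sup>2))) (at 0)"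
      by (rule DERIV_arcsin) auto
    then obtain d where "0 < d" and d: "\<And>x. \<bar>x\<bar> < d \<Longrightarrow> \<bar>arcsin x - x\<bar> \<le> e * \<bar>x\<bar>"
      using \<open>0 < e\<close> by (auto elim!: derivative_one_at_zero)
    have "uniformly_continuous_on {0..1} g"
      using assms(2) by (intro compact_uniformly_continuous) (auto simp: path_def)
    then obtain r where "0 < r" and r: "\<And>u v. u \<in> {0..1} \<Longrightarrow> v \<in> {0..1} \<Longrightarrow> dist v u < r \<Longrightarrow>
        dist (g v) (g u) < \<rho> * d"
      using \<open>0 < d\<close> assms(1) unfolding uniformly_continuous_on_def
      by (metis mult_pos_pos)
    obtain n :: nat where n: "0 < n" "1 / real n < r"
      using \<open>0 < r\<close> by (metis nat_approx_posE zero_less_Suc)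
    define \<tau> where "\<tau> = (\<lambda>i. min 1 (real i / real n))"
    have \<tau>: "\<tau> i \<in> {0..1}" for i
      by (simp add: \<tau>_def)
    have ends: "\<tau> 0 = 0" "\<tau> n = 1"
      using n(1) by (auto simp: \<tau>_def)
    have mono: "mono \<tau>"
      using n(1) by (auto simp: mono_def \<tau>_def divide_right_mono min_le_iff_disj)
    have step: "arccos (G (\<tau> i) \<bullet> G (\<tau> (Suc i))) \<le> (1 + e) * dist (G (\<tau> i)) (G (\<tau> (Suc i)))" for i
    proof -
      have "dist (\<tau> i) (\<tau> (Suc i)) \<le> 1 / real n"
        using n(1) by (auto simp: \<tau>_def dist_real_def min_def field_simps)
      then have "dist (g (\<tau> i)) (g (\<tau> (Suc i))) < \<rho> * d"
        using n(2) by (intro r \<tau>) simp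
      then have small: "\<bar>dist (G (\<tau> i)) (G (\<tau> (Suc i))) / 2\<bar> < d"
        using assms(1) \<open>0 < d\<close> distG[of "\<tau> i" "\<tau> (Suc i)"] by simp
      have "arccos (G (\<tau> i) \<bullet> G (\<tau> (Suc i))) = 2 * arcsin (dist (G (\<tau> i)) (G (\<tau> (Suc i))) / 2)"
        using G1[OF \<tau>] by (intro arccos_inner_chord) auto
      then show ?thesis
        using abs_le_D1[OF d[OF small]] by (simp add: algebra_simps)
    qed
    have arcs: "arccos (G (\<tau> 0) \<bullet> G (\<tau> k)) \<le> (\<Sum>i<k. arccos (G (\<tau> i) \<bullet> G (\<tau> (Suc i))))" for k
    proof (induction k)
      case 0
      show ?case using G1[OF \<tau>[of 0]] by (simp add: dot_square_norm)
    next
      case (Suc k)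
      then show ?case
        using arccos_inner_triangle[of "G (\<tau> 0)" "G (\<tau> k)" "G (\<tau> (Suc k))"] G1[OF \<tau>] by simp
    qed
    have "\<rho> * arccos (G 0 \<bullet> G 1) \<le> \<rho> * (\<Sum>i<n. (1 + e) * dist (G (\<tau> i)) (G (\<tau> (Suc i))))"
      using arcs[of n] ends assms(1) order_trans[OF _ sum_mono[OF step]]
      by (intro mult_left_mono) auto
    also have "\<dots> = (1 + e) * (\<Sum>i<n. dist (g (\<tau> i)) (g (\<tau> (Suc i))))"
      by (simp add: distG sum_distrib_left algebra_simps)
    finally have "ennreal (\<rho> * arccos (G 0 \<bullet> G 1))
        \<le> ennreal ((1 + e) * (\<Sum>i<n. dist (g (\<tau> i)) (g (\<tau> (Suc i)))))"
      by (rule ennreal_leI)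
    also have "\<dots> = ennreal (1 + e) * (\<Sum>i<n. ennreal (dist (g (\<tau> i)) (g (\<tau> (Suc i)))))"
      using \<open>0 < e\<close> by (simp add: ennreal_mult sum_nonneg)
    also have "\<dots> \<le> ennreal (1 + e) * curve_length g"
      using mono \<tau> by (intro mult_left_mono polygon_le_curve_length) auto
    finally show ?thesis .
  qed
  have "ennreal (\<rho> * arccos (G 0 \<bullet> G 1)) \<le> curve_length g"
  proof (cases "curve_length g")
    case (real l)
    have "\<rho> * arccos (G 0 \<bullet> G 1) \<le> l"
    proof (rule field_le_mult_one_interval)
      fix z :: real assume z: "0 < z" "z < 1"
      have "ennreal (\<rho> * arccos (G 0 \<bullet> G 1)) \<le> ennreal (1 / z) * ennreal l"
        using bound[of "1 / z - 1"] z real by (simp add: field_simps)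
      then have "\<rho> * arccos (G 0 \<bullet> G 1) \<le> (1 / z) * l"
        using z real by (simp flip: ennreal_mult add: ennreal_le_iff)
      then show "z * (\<rho> * arccos (G 0 \<bullet> G 1)) \<le> l"
        using z by (simp add: field_simps)
    qed
    then show ?thesis
      using real by (simp add: ennreal_leI)
  qed simp
  then show ?thesis
    by (simp add: innG pathstart_def pathfinish_def)
qed

corollary great_circle_le_inner_dist:
  assumes "0 < \<rho>"
  shows "ennreal (\<rho> * arccos (x \<bullet> y / \<rho>\<^sup>2)) \<le> inner_dist (sphere 0 \<rho>) x y"
proof (rule inner_dist_greatest)
  fix g assume "path g" "path_image g \<subseteq> sphere 0 \<rho>" "pathstart g = x" "pathfinish g = y"
  then show "ennreal (\<rho> * arccos (x \<bullet> y / \<rho>\<^sup>2)) \<le> curve_length g"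
    using curve_length_ge_great_circle[OF assms, of g] by simp
qed

lemma inner_dist_sphere:
  fixes x y :: point
  assumes "0 < \<rho>" and x: "norm x = \<rho>" and y: "norm y = \<rho>" and "x \<noteq> - y"
  shows "inner_dist (sphere 0 \<rho>) x y = ennreal (\<rho> * arccos (x \<bullet> y / \<rho>\<^sup>2))"
proof (rule antisym)
  show "ennreal (\<rho> * arccos (x \<bullet> y / \<rho>\<^sup>2)) \<le> inner_dist (sphere 0 \<rho>) x y"
    using assms(1) by (rule great_circle_le_inner_dist)
  define c where "c = x \<bullet> y / \<rho>\<^sup>2"
  define \<theta> where "\<theta> = arccos c"
  have xx: "x \<bullet> x = \<rho>\<^sup>2" "y \<bullet> y = \<rho>\<^sup>2" and xy: "x \<bullet> y = c * \<rho>\<^sup>2"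
    using x y assms(1) by (simp_all add: dot_square_norm c_def)
  have "\<bar>x \<bullet> y\<bar> \<le> \<rho>\<^sup>2"
    using Cauchy_Schwarz_ineq2[of x y] x y by (simp add: power2_eq_square)
  then have c: "-1 \<le> c" "c \<le> 1"
    using assms(1) by (auto simp: c_def field_simps abs_le_iff)
  have "c \<noteq> -1"
  proof
    assume "c = -1"
    then have "(x + y) \<bullet> (x + y) = 0"
      by (simp add: inner_add_left inner_add_right xx xy inner_commute[of y x])
    then show False
      using \<open>x \<noteq> - y\<close> by (simp add: eq_neg_iff_add_eq_0)
  qed
  show "inner_dist (sphere 0 \<rho>) x y \<le> ennreal (\<rho> * arccos (x \<bullet> y / \<rho>\<^sup>2))"
  proof (cases "c = 1")
    case True
    then have "(x - y) \<bullet> (x - y) = 0"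
      by (simp add: inner_diff_left inner_diff_right xx xy inner_commute[of y x])
    then have "x = y" by simp
    then show ?thesis
      using x by (simp add: inner_dist_refl)
  next
    case False
    \<comment> \<open>The great circle arc, written in the orthogonal frame \<open>x\<close>, \<open>e\<close> of the plane of \<open>x\<close> and \<open>y\<close>.\<close>
    have \<theta>: "cos \<theta> = c" "0 \<le> \<theta>" "sin \<theta> = sqrt (1 - c\<^sup>2)"
      using c by (auto simp: \<theta>_def arccos_lbound sin_arccos)
    have s2: "(sin \<theta>)\<^sup>2 = 1 - c\<^sup>2"
      using \<theta>(1) by (simp add: sin_squared_eq)
    have "c\<^sup>2 \<noteq> 1"
      using False \<open>c \<noteq> -1\<close> by (simp add: power2_eq_1_iff)
    then have s0: "sin \<theta> \<noteq> 0"
      using s2 by auto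
    define e where "e = (y - c *\<^sub>R x) /\<^sub>R sin \<theta>"
    have xe: "x \<bullet> e = 0"
      by (simp add: e_def inner_diff_right xx xy)
    have "(y - c *\<^sub>R x) \<bullet> (y - c *\<^sub>R x) = (1 - c\<^sup>2) * \<rho>\<^sup>2"
      by (simp add: inner_diff_left inner_diff_right xx xy inner_commute[of y x] power2_eq_square
          algebra_simps)
    then have ee: "e \<bullet> e = \<rho>\<^sup>2"
      using s0 by (simp add: e_def s2[symmetric]) (simp add: power2_eq_square field_simps del: mult_eq_0_iff)
    define \<gamma> where "\<gamma> = (\<lambda>u. cos (u * \<theta>) *\<^sub>R x + sin (u * \<theta>) *\<^sub>R e)"
    have \<gamma>: "\<gamma> u \<bullet> \<gamma> v = \<rho>\<^sup>2 * cos ((u - v) * \<theta>)" for u v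
    proof -
      have "\<gamma> u \<bullet> \<gamma> v = cos (u * \<theta>) * (cos (v * \<theta>) * \<rho>\<^sup>2) + sin (u * \<theta>) * (sin (v * \<theta>) * \<rho>\<^sup>2)"
        by (simp add: \<gamma>_def inner_add_left inner_add_right xx xe ee inner_commute[of e x])
      then show ?thesis
        by (simp only: left_diff_distrib cos_diff) (simp only: ring_distribs mult_ac)
    qed
    show ?thesis
    proof (rule inner_dist_lipschitz[where g=\<gamma>])
      show "0 \<le> \<rho> * arccos (x \<bullet> y / \<rho>\<^sup>2)"
        using assms(1) \<theta>(2) by (simp add: \<theta>_def c_def)
      fix u v :: real
      have "(dist (\<gamma> u) (\<gamma> v))\<^sup>2 = 2 * \<rho>\<^sup>2 * (1 - cos ((u - v) * \<theta>))"
        using \<gamma>[of u u] \<gamma>[of v v] \<gamma>[of u v] inner_commute[of "\<gamma> v" "\<gamma> u"]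
        by (simp add: dist_norm power2_norm_eq_inner inner_diff_left inner_diff_right algebra_simps)
      also have "1 - cos ((u - v) * \<theta>) = 2 * (sin ((u - v) * \<theta> / 2))\<^sup>2"
        using cos_double_sin[of "(u - v) * \<theta> / 2"] by simp
      also have "2 * \<rho>\<^sup>2 * (2 * (sin ((u - v) * \<theta> / 2))\<^sup>2) \<le> 2 * \<rho>\<^sup>2 * (2 * ((u - v) * \<theta> / 2)\<^sup>2)"
        using abs_sin_x_le_abs_x[of "(u - v) * \<theta> / 2"]
        by (intro mult_left_mono) (simp_all only: abs_le_square_iff zero_le_power2 zero_le_numeral
            mult_nonneg_nonneg)
      also have "\<dots> = (\<rho> * \<theta> * \<bar>u - v\<bar>)\<^sup>2"
        by (simp add: power_mult_distrib power_divide)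
      finally show "dist (\<gamma> u) (\<gamma> v) \<le> \<rho> * arccos (x \<bullet> y / \<rho>\<^sup>2) * \<bar>u - v\<bar>"
        using assms(1) \<theta>(2) by (simp add: \<theta>_def c_def power2_le_iff_abs_le)
    next
      show "\<gamma> ` {0..1} \<subseteq> sphere 0 \<rho>"
        using \<gamma> assms(1) by (auto simp: norm_eq_sqrt_inner)
      show "\<gamma> 0 = x" "\<gamma> 1 = y"
        using s0 \<theta>(1) by (simp_all add: \<gamma>_def e_def)
    qed
  qed
qed

text \<open>The bound \<open>d < \<rho> * pi\<close> excludes antipodal points, between which there is no distinguished great
  circle arc.\<close>
lemma inner_of_sphere_dist:
  fixes x y :: point
  assumes "0 < \<rho>" and "norm x = \<rho>" and "norm y = \<rho>"
    and d: "inner_dist (sphere 0 \<rho>) x y = ennreal d" and "0 \<le> d" and "d < \<rho> * pi"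
  shows "x \<bullet> y = \<rho>\<^sup>2 * cos (d / \<rho>)"
proof -
  have bnd: "\<bar>x \<bullet> y / \<rho>\<^sup>2\<bar> \<le> 1"
    using Cauchy_Schwarz_ineq2[of x y] assms(1-3) by (simp add: power2_eq_square)
  have ge: "ennreal (\<rho> * arccos (x \<bullet> y / \<rho>\<^sup>2)) \<le> inner_dist (sphere 0 \<rho>) x y"
    using assms(1) by (rule great_circle_le_inner_dist)
  have "x \<noteq> - y"
  proof
    assume "x = - y"
    then have "x \<bullet> y / \<rho>\<^sup>2 = -1"
      using assms(1,3) by (simp add: dot_square_norm)
    then show False
      using ge d assms(1,5,6) by (simp add: ennreal_le_iff)
  qed
  then have "ennreal (\<rho> * arccos (x \<bullet> y / \<rho>\<^sup>2)) = ennreal d"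
    using inner_dist_sphere[OF assms(1-3)] d by simp
  moreover have "0 \<le> \<rho> * arccos (x \<bullet> y / \<rho>\<^sup>2)"
    using assms(1) bnd by (intro mult_nonneg_nonneg arccos_lbound) (auto simp only: abs_le_iff)
  ultimately have "arccos (x \<bullet> y / \<rho>\<^sup>2) = d / \<rho>"
    using assms(1,5) by (simp add: ennreal_inj field_simps)
  then have "x \<bullet> y / \<rho>\<^sup>2 = cos (d / \<rho>)"
    using bnd by (metis abs_le_iff cos_arccos minus_le_iff)
  then show ?thesis
    using assms(1) by (simp add: field_simps)
qed

text \<open>The difference of the two sides has squared norm zero, as the Gram matrix of \<open>p\<close>, \<open>x\<close>, \<open>y\<close> shows. So two
  points of a great circle arc determine its further points.\<close>
lemma sphere_arc_extension:
  fixes p x y :: "'a::real_inner"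
  assumes "p \<bullet> p = \<rho>\<^sup>2" "x \<bullet> x = \<rho>\<^sup>2" "y \<bullet> y = \<rho>\<^sup>2"
    and "p \<bullet> x = \<rho>\<^sup>2 * cos a" "p \<bullet> y = \<rho>\<^sup>2 * cos b" "x \<bullet> y = \<rho>\<^sup>2 * cos (b - a)"
  shows "sin a *\<^sub>R y = sin b *\<^sub>R x - sin (b - a) *\<^sub>R p"
proof -
  let ?v = "sin a *\<^sub>R y - sin b *\<^sub>R x + sin (b - a) *\<^sub>R p"
  have "?v \<bullet> ?v = \<rho>\<^sup>2 * ((sin a)\<^sup>2 + (sin b)\<^sup>2 + (sin (b - a))\<^sup>2 - 2 * sin a * sin b * cos (b - a)
      + 2 * sin a * sin (b - a) * cos b - 2 * sin b * sin (b - a) * cos a)"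
    using assms inner_commute[of y x] inner_commute[of x p] inner_commute[of y p]
    by (simp add: inner_add_left inner_add_right inner_diff_left inner_diff_right
        power2_eq_square algebra_simps)
  also have "(sin a)\<^sup>2 + (sin b)\<^sup>2 + (sin (b - a))\<^sup>2 - 2 * sin a * sin b * cos (b - a)
      + 2 * sin a * sin (b - a) * cos b - 2 * sin b * sin (b - a) * cos a = 0"
    unfolding sin_diff cos_diff
    using sin_cos_squared_add[of a] sin_cos_squared_add[of b] by algebra
  finally have "?v \<bullet> ?v = 0" by simp
  then have "?v = 0" by simp
  then show ?thesis by (simp add: algebra_simps)
qed

text \<open>Shortest arcs on a sphere do not branch, and even two different ones from a common point
  separate at a linear rate: by \<open>sphere_arc_extension\<close> the distance of their points at \<open>s\<close> is
  proportional to that of their points at \<open>r\<close>, with a factor comparable to \<open>1 / r\<close>.\<close>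
lemma sphere_arcs_tangent_eq:
  fixes g h :: "real \<Rightarrow> point"
  assumes "0 < \<rho>" and s: "0 < s" "s < \<rho> * pi"
    and g_in: "\<And>r. r \<in> {0..s} \<Longrightarrow> norm (g r) = \<rho>" and h_in: "\<And>r. r \<in> {0..s} \<Longrightarrow> norm (h r) = \<rho>"
    and g: "\<And>r q. r \<in> {0..s} \<Longrightarrow> q \<in> {0..s} \<Longrightarrow> inner_dist (sphere 0 \<rho>) (g r) (g q) = ennreal \<bar>r - q\<bar>"
    and h: "\<And>r q. r \<in> {0..s} \<Longrightarrow> q \<in> {0..s} \<Longrightarrow> inner_dist (sphere 0 \<rho>) (h r) (h q) = ennreal \<bar>r - q\<bar>"
    and "g 0 = h 0"
    and tangent: "\<And>e d. 0 < e \<Longrightarrow> 0 < d \<Longrightarrow> \<exists>r. 0 < r \<and> r < d \<and> dist (g r) (h r) \<le> e * r"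
  shows "g s = h s"
proof -
  have ext: "sin (r / \<rho>) *\<^sub>R k s = sin (s / \<rho>) *\<^sub>R k r - sin (s / \<rho> - r / \<rho>) *\<^sub>R k 0"
    if "r \<in> {0..s}" and k_in: "\<And>r. r \<in> {0..s} \<Longrightarrow> norm (k r) = \<rho>"
      and k: "\<And>r q. r \<in> {0..s} \<Longrightarrow> q \<in> {0..s} \<Longrightarrow> inner_dist (sphere 0 \<rho>) (k r) (k q) = ennreal \<bar>r - q\<bar>"
    for k :: "real \<Rightarrow> point" and r
  proof (rule sphere_arc_extension)
    have inn: "k a \<bullet> k b = \<rho>\<^sup>2 * cos (\<bar>a - b\<bar> / \<rho>)" if "a \<in> {0..s}" "b \<in> {0..s}" for a b
      using that s assms(1) k_in k by (intro inner_of_sphere_dist) auto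
    show "k 0 \<bullet> k 0 = \<rho>\<^sup>2" "k r \<bullet> k r = \<rho>\<^sup>2" "k s \<bullet> k s = \<rho>\<^sup>2"
      using inn[of 0 0] inn[of r r] inn[of s s] that(1) s by auto
    show "k 0 \<bullet> k r = \<rho>\<^sup>2 * cos (r / \<rho>)" "k 0 \<bullet> k s = \<rho>\<^sup>2 * cos (s / \<rho>)"
      using inn[of 0 r] inn[of 0 s] that(1) s by auto
    show "k r \<bullet> k s = \<rho>\<^sup>2 * cos (s / \<rho> - r / \<rho>)"
      using inn[of r s] that(1) by (simp add: abs_minus_commute diff_divide_distrib)
  qed
  have sep: "sin (r / \<rho>) * dist (g s) (h s) \<le> dist (g r) (h r)" if r: "r \<in> {0..s}" for r
  proof -
    have "0 \<le> sin (r / \<rho>)"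
      using r s assms(1) by (intro sin_ge_zero) (auto simp: field_simps)
    have "sin (r / \<rho>) *\<^sub>R (g s - h s) = sin (s / \<rho>) *\<^sub>R (g r - h r)"
      using ext[OF r g_in g] ext[OF r h_in h] \<open>g 0 = h 0\<close> by (simp add: scaleR_diff_right)
    then have "\<bar>sin (r / \<rho>)\<bar> * norm (g s - h s) = \<bar>sin (s / \<rho>)\<bar> * norm (g r - h r)"
      by (metis norm_scaleR)
    also have "\<dots> \<le> 1 * norm (g r - h r)"
      by (intro mult_right_mono) auto
    finally show ?thesis
      using \<open>0 \<le> sin (r / \<rho>)\<close> by (simp add: dist_norm)
  qed
  have "(sin has_field_derivative cos 0) (at (0::real))"
    by (rule DERIV_sin)
  then obtain d where "0 < d" and d: "\<And>x::real. \<bar>x\<bar> < d \<Longrightarrow> \<bar>sin x - x\<bar> \<le> 1/2 * \<bar>x\<bar>"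
    using derivative_one_at_zero[of sin "1/2"] by auto
  have "dist (g s) (h s) \<le> e" if "0 < e" for e
  proof -
    obtain r where r: "0 < r" "r < min s (\<rho> * d)" "dist (g r) (h r) \<le> e / (2 * \<rho>) * r"
      using tangent[of "e / (2 * \<rho>)" "min s (\<rho> * d)"] \<open>0 < e\<close> \<open>0 < d\<close> s assms(1) by auto
    have "\<bar>r / \<rho>\<bar> < d"
      using r assms(1) by (simp add: field_simps)
    then have "\<bar>sin (r / \<rho>) - r / \<rho>\<bar> \<le> 1/2 * \<bar>r / \<rho>\<bar>"
      by (rule d)
    then have "r / \<rho> - 1/2 * (r / \<rho>) \<le> sin (r / \<rho>)"
      using r(1) assms(1) by (simp only: abs_le_iff abs_of_pos divide_pos_pos) linarith
    then have "r / (2 * \<rho>) \<le> sin (r / \<rho>)"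
      by simp
    then have "r / (2 * \<rho>) * dist (g s) (h s) \<le> sin (r / \<rho>) * dist (g s) (h s)"
      by (rule mult_right_mono) simp
    also have "\<dots> \<le> r / (2 * \<rho>) * e"
      using order_trans[OF sep[of r] r(3)] r(1,2) by (simp add: mult_ac)
    finally show ?thesis
      using r(1) assms(1) by (simp add: field_simps)
  qed
  then have "dist (g s) (h s) \<le> 0"
    by (rule field_le_epsilon) auto
  then show ?thesis by simp
qed

section \<open>Triangles and their angle at the apex\<close>

text \<open>The right side is run through against its orientation in the triangle, so that both parameters are
  distances from the apex.\<close>
definition side_params :: "tri \<Rightarrow> real \<Rightarrow> real \<Rightarrow> (real \<Rightarrow> point) \<Rightarrow> (real \<Rightarrow> point) \<Rightarrow> bool" where
  "side_params t a b g h \<longleftrightarrow> 0 < a \<and> 0 < b \<and> g 0 = apex t \<and> h 0 = apex t \<and> g a = lvert t \<and> h b = rvert t \<and>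
     g ` {0..a} = lside t \<and> h ` {0..b} = rside t \<and> unit_speed (region t) a g \<and> unit_speed (region t) b h"

text \<open>The boundary curve of the triangle is the image of a circle under a homeomorphism from the closed disc
  onto a subspace of the triangle, so the sides lie in the triangle and are unit speed curves there.\<close>
lemma triangle_on_side_params:
  assumes "triangle_on X t"
  obtains g h where "side_params t (idist X (apex t) (lvert t)) (idist X (rvert t) (apex t)) g h"
    and "unit_speed X (idist X (apex t) (lvert t)) g" and "unit_speed X (idist X (rvert t) (apex t)) h"
    and "lside t \<inter> rside t = {apex t}"
proof -
  let ?ps = "[apex t, lvert t, rvert t]" and ?Ss = "[lside t, base t, rside t]"
  have poly: "geodesic_polygon X (idist X) ?ps ?Ss (region t)"
    using assms by (simp add: triangle_on_def)
  have arc: "shortest_arc X (idist X) (?Ss ! i) (?ps ! i) (?ps ! (Suc i mod length ?ps))"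
    if "i < length ?ps" for i
    using poly that unfolding geodesic_polygon_def by blast
  have meet: "?Ss ! i \<inter> ?Ss ! (Suc i mod length ?ps) = {?ps ! (Suc i mod length ?ps)}"
    if "i < length ?ps" for i
    using poly that unfolding geodesic_polygon_def by blast
  have dist: "distinct ?ps" and TX: "region t \<subseteq> X"
    using poly unfolding geodesic_polygon_def by blast+
  have l: "shortest_arc X (idist X) (lside t) (apex t) (lvert t)"
    using arc[of 0] by simp
  have r: "shortest_arc X (idist X) (rside t) (rvert t) (apex t)"
    using arc[of 2] by (simp add: numeral_2_eq_2)
  have inter: "lside t \<inter> rside t = {apex t}"
    using meet[of 2] by (simp add: numeral_2_eq_2 Int_commute)
  have "\<exists>f. homeomorphic_map (top_of_set (cball (0 :: complex) 1))
      (subtopology (Metric_space.mtopology X (idist X)) (region t)) f \<and> f ` sphere 0 1 = \<Union> (set ?Ss)"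
    using poly unfolding geodesic_polygon_def by (elim conjE)
  then obtain f where f: "homeomorphic_map (top_of_set (cball (0 :: complex) 1))
      (subtopology (Metric_space.mtopology X (idist X)) (region t)) f" and fs: "f ` sphere 0 1 = \<Union> (set ?Ss)"
    by (elim exE conjE)
  have "f ` cball 0 1 = topspace (subtopology (Metric_space.mtopology X (idist X)) (region t))"
    using homeomorphic_imp_surjective_map[OF f] by simp
  then have "f ` cball 0 1 \<subseteq> region t"
    by simp
  then have "\<Union> (set ?Ss) \<subseteq> region t"
    unfolding fs[symmetric] using image_mono[OF sphere_cball, of f 0 1] by (rule order_trans[rotated])
  then have sides: "lside t \<subseteq> region t" "rside t \<subseteq> region t"
    by simp_all
  let ?a = "idist X (apex t) (lvert t)" and ?b = "idist X (rvert t) (apex t)"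
  obtain g where g: "g 0 = apex t" "g ?a = lvert t" "g ` {0..?a} = lside t"
    and g_unit: "\<And>T. lside t \<subseteq> T \<Longrightarrow> T \<subseteq> X \<Longrightarrow> unit_speed T ?a g"
    using shortest_arc_unit_speed[OF l] by metis
  obtain k where k: "k 0 = rvert t" "k ?b = apex t" "k ` {0..?b} = rside t"
    and k_unit: "\<And>T. rside t \<subseteq> T \<Longrightarrow> T \<subseteq> X \<Longrightarrow> unit_speed T ?b k"
    using shortest_arc_unit_speed[OF r] by metis
  have "0 \<le> ?a" "0 \<le> ?b"
    by (simp_all add: idist_def)
  moreover have "?a \<noteq> 0" "?b \<noteq> 0"
    using g(1,2) k(1,2) dist by auto
  ultimately have pos: "0 < ?a" "0 < ?b"
    by simp_all
  \<comment> \<open>The right side is reversed, so that both parameters start at the apex.\<close>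
  define h where "h = (\<lambda>s. k (?b - s))"
  have h_unit: "unit_speed T ?b h" if "rside t \<subseteq> T" "T \<subseteq> X" for T
  proof -
    have "(?b - s) \<in> {0..?b}" if "s \<in> {0..?b}" for s
      using that by auto
    moreover have "\<bar>(?b - s) - (?b - r)\<bar> = \<bar>s - r\<bar>" for s r
      by linarith
    ultimately show ?thesis
      using k_unit[OF that] unfolding unit_speed_def h_def image_subset_iff by metis
  qed
  have h_img: "h ` {0..?b} = rside t"
  proof -
    have "(\<lambda>s. ?b - s) ` {0..?b} = {0..?b}"
      by (simp add: image_diff_atLeastAtMost)
    then show ?thesis
      unfolding h_def k(3)[symmetric] by (metis image_image)
  qed
  show thesis
  proof (rule that)
    show "side_params t ?a ?b g h"
      unfolding side_params_def
      using pos g k h_img g_unit[OF sides(1) TX] h_unit[OF sides(2) TX] by (simp add: h_def)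
    show "unit_speed X ?a g" "unit_speed X ?b h"
      using g_unit h_unit sides TX by auto
  qed (rule inter)
qed

locale parametrized_triangle =
  fixes t :: tri and a b :: real and g h :: "real \<Rightarrow> point"
  assumes params: "side_params t a b g h"
begin

lemma
  shows a_pos: "0 < a" and b_pos: "0 < b" and g_0: "g 0 = apex t" and h_0: "h 0 = apex t"
    and g_a: "g a = lvert t" and h_b: "h b = rvert t"
    and g_image: "g ` {0..a} = lside t" and h_image: "h ` {0..b} = rside t"
    and g_unit: "unit_speed (region t) a g" and h_unit: "unit_speed (region t) b h"
  using params by (simp_all add: side_params_def)

lemma g_in: "s \<in> {0..a} \<Longrightarrow> g s \<in> region t" and h_in: "r \<in> {0..b} \<Longrightarrow> h r \<in> region t"
  using g_unit h_unit unfolding unit_speed_def by auto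

lemma inner_dist_apex_g: "s \<in> {0..a} \<Longrightarrow> inner_dist (region t) (apex t) (g s) = ennreal s"
  using unit_speed_dist[OF g_unit, of 0 s] a_pos g_0 by simp

lemma inner_dist_apex_h: "r \<in> {0..b} \<Longrightarrow> inner_dist (region t) (apex t) (h r) = ennreal r"
  using unit_speed_dist[OF h_unit, of 0 r] b_pos h_0 by simp

lemma idist_apex_g: "s \<in> {0..a} \<Longrightarrow> idist (region t) (apex t) (g s) = s"
  and idist_apex_h: "r \<in> {0..b} \<Longrightarrow> idist (region t) (apex t) (h r) = r"
  by (simp_all add: idist_def inner_dist_apex_g inner_dist_apex_h)

text \<open>These are the triangle inequalities for the apex and the two points. They put the law-of-cosines
  quotient into the range where \<open>arccos\<close> inverts \<open>cos\<close>.\<close>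
lemma inner_dist_sides:
  assumes s: "s \<in> {0..a}" and r: "r \<in> {0..b}"
  shows "inner_dist (region t) (g s) (h r) = ennreal (idist (region t) (g s) (h r))"
    and "idist (region t) (g s) (h r) \<le> s + r" and "\<bar>s - r\<bar> \<le> idist (region t) (g s) (h r)"
proof -
  let ?d = "inner_dist (region t)"
  have s0: "0 \<le> s" and r0: "0 \<le> r"
    using s r by auto
  have "?d (g s) (h r) \<le> ?d (g s) (apex t) + ?d (apex t) (h r)"
    by (rule inner_dist_triangle)
  also have "\<dots> = ennreal (s + r)"
    using inner_dist_apex_g[OF s] inner_dist_apex_h[OF r] inner_dist_commute s0 r0
    by (metis ennreal_plus)
  finally have le: "?d (g s) (h r) \<le> ennreal (s + r)" .
  then have "?d (g s) (h r) < top"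
    by (metis ennreal_less_top le_less_trans)
  then show fin: "?d (g s) (h r) = ennreal (idist (region t) (g s) (h r))"
    by (simp add: idist_def)
  have nn: "0 \<le> idist (region t) (g s) (h r)"
    by (simp add: idist_def)
  show "idist (region t) (g s) (h r) \<le> s + r"
    using le s0 r0 unfolding fin by (simp add: ennreal_le_iff del: ennreal_plus)
  have "ennreal s \<le> ennreal r + ennreal (idist (region t) (g s) (h r))"
    using inner_dist_triangle[of "region t" "apex t" "g s" "h r"] inner_dist_commute[of _ "h r" "g s"]
    by (simp add: inner_dist_apex_g[OF s] inner_dist_apex_h[OF r] fin)
  then have 1: "s \<le> r + idist (region t) (g s) (h r)"
    using r0 nn by (simp flip: ennreal_plus add: ennreal_le_iff)
  have "ennreal r \<le> ennreal s + ennreal (idist (region t) (g s) (h r))"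
    using inner_dist_triangle[of "region t" "apex t" "h r" "g s"]
    by (simp add: inner_dist_apex_g[OF s] inner_dist_apex_h[OF r] fin)
  then have 2: "r \<le> s + idist (region t) (g s) (h r)"
    using s0 nn by (simp flip: ennreal_plus add: ennreal_le_iff)
  show "\<bar>s - r\<bar> \<le> idist (region t) (g s) (h r)"
    using 1 2 by simp
qed

definition cos_quot :: "real \<Rightarrow> real \<Rightarrow> real" where
  "cos_quot s r = (s\<^sup>2 + r\<^sup>2 - (idist (region t) (g s) (h r))\<^sup>2) / (2 * s * r)"

lemma cos_quot_bounds:
  assumes "s \<in> {0<..a}" and "r \<in> {0<..b}"
  shows "-1 \<le> cos_quot s r" and "cos_quot s r \<le> 1"
proof -
  have sr: "s \<in> {0..a}" "r \<in> {0..b}" and pos: "0 < s" "0 < r"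
    using assms by auto
  let ?d = "idist (region t) (g s) (h r)"
  have "0 \<le> ?d"
    by (simp add: idist_def)
  then have "?d\<^sup>2 \<le> (s + r)\<^sup>2"
    using inner_dist_sides(2)[OF sr] by (intro power_mono)
  then show "-1 \<le> cos_quot s r"
    using pos by (simp add: cos_quot_def field_simps power2_eq_square)
  have "(s - r)\<^sup>2 \<le> ?d\<^sup>2"
    using inner_dist_sides(3)[OF sr] \<open>0 \<le> ?d\<close> by (simp add: abs_le_square_iff[symmetric])
  then show "cos_quot s r \<le> 1"
    using pos by (simp add: cos_quot_def field_simps power2_eq_square)
qed

abbreviation "side_filter \<equiv> (at (apex t) within lside t) \<times>\<^sub>F (at (apex t) within rside t)"

lemma eventually_side_filterD:
  assumes "eventually P side_filter"
  shows "\<exists>d>0. d \<le> a \<and> d \<le> b \<and> (\<forall>s r. 0 < s \<and> s < d \<and> 0 < r \<and> r < d \<longrightarrow> P (g s, h r))"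
proof -
  obtain Q R where Q: "eventually Q (at (apex t) within lside t)"
    and R: "eventually R (at (apex t) within rside t)" and QR: "\<And>x y. Q x \<Longrightarrow> R y \<Longrightarrow> P (x, y)"
    using assms unfolding eventually_prod_filter by blast
  obtain d1 where d1: "0 < d1" "\<And>x. x \<in> lside t \<Longrightarrow> x \<noteq> apex t \<Longrightarrow> dist x (apex t) < d1 \<Longrightarrow> Q x"
    using Q unfolding eventually_at by blast
  obtain d2 where d2: "0 < d2" "\<And>x. x \<in> rside t \<Longrightarrow> x \<noteq> apex t \<Longrightarrow> dist x (apex t) < d2 \<Longrightarrow> R x"
    using R unfolding eventually_at by blast
  have "P (g s, h r)" if s: "0 < s" "s < min (min d1 d2) (min a b)"
    and r: "0 < r" "r < min (min d1 d2) (min a b)" for s r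
  proof -
    have sr: "s \<in> {0..a}" "r \<in> {0..b}"
      using s r by auto
    have "ennreal (dist (apex t) (g s)) \<le> ennreal s" "ennreal (dist (apex t) (h r)) \<le> ennreal r"
      using dist_le_inner_dist inner_dist_apex_g[OF sr(1)] inner_dist_apex_h[OF sr(2)] by metis+
    then have small: "dist (g s) (apex t) < d1" "dist (h r) (apex t) < d2"
      using s r by (auto simp: ennreal_le_iff dist_commute)
    have "apex t \<in> region t"
      using g_in[of 0] a_pos g_0 by simp
    then have "g s \<noteq> apex t" "h r \<noteq> apex t"
      using idist_apex_g[OF sr(1)] idist_apex_h[OF sr(2)] inner_dist_refl[of "apex t" "region t"] s(1) r(1)
      by (auto simp: idist_def)
    moreover have "g s \<in> lside t" "h r \<in> rside t"
      using sr g_image h_image by blast+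
    ultimately show ?thesis
      by (intro QR d1(2) d2(2) small)
  qed
  moreover have "0 < min (min d1 d2) (min a b)"
    using d1 d2 a_pos b_pos by simp
  ultimately show ?thesis
    by (intro exI[of _ "min (min d1 d2) (min a b)"]) auto
qed

lemma eventually_side_filterI:
  assumes "\<And>s r. s \<in> {0<..a} \<Longrightarrow> r \<in> {0<..b} \<Longrightarrow> P (g s, h r)"
  shows "eventually P side_filter"
  unfolding eventually_prod_filter
proof (intro exI conjI allI impI)
  show "eventually (\<lambda>x. x \<in> g ` {0<..a}) (at (apex t) within lside t)"
  proof -
    have "x \<in> g ` {0<..a}" if x: "x \<in> lside t" "x \<noteq> apex t" for x
    proof -
      obtain s where "s \<in> {0..a}" "x = g s"
        using x(1) unfolding g_image[symmetric] by blast
      moreover from this have "s \<noteq> 0"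
        using x(2) g_0 by auto
      ultimately show ?thesis by auto
    qed
    then show ?thesis
      by (simp add: eventually_at_filter)
  qed
  show "eventually (\<lambda>x. x \<in> h ` {0<..b}) (at (apex t) within rside t)"
  proof -
    have "x \<in> h ` {0<..b}" if x: "x \<in> rside t" "x \<noteq> apex t" for x
    proof -
      obtain s where "s \<in> {0..b}" "x = h s"
        using x(1) unfolding h_image[symmetric] by blast
      moreover from this have "s \<noteq> 0"
        using x(2) h_0 by auto
      ultimately show ?thesis by auto
    qed
    then show ?thesis
      by (simp add: eventually_at_filter)
  qed
  fix x y assume "x \<in> g ` {0<..a}" "y \<in> h ` {0<..b}"
  then show "P (x, y)"
    using assms by auto
qed

lemma side_filter_nontrivial: "side_filter \<noteq> bot"
proof
  assume "side_filter = bot"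
  then have "eventually (\<lambda>_. False) side_filter"
    by simp
  from eventually_side_filterD[OF this] obtain d :: real
    where "0 < d" and d: "\<forall>s r. 0 < s \<and> s < d \<and> 0 < r \<and> r < d \<longrightarrow> False"
    by blast
  show False
    using d[rule_format, of "d/2" "d/2"] \<open>0 < d\<close> by simp
qed

definition angle_quot :: "point \<times> point \<Rightarrow> real" where
  "angle_quot = (\<lambda>(x, y). arccos (((idist (region t) (apex t) x)\<^sup>2 + (idist (region t) (apex t) y)\<^sup>2
      - (idist (region t) x y)\<^sup>2) / (2 * idist (region t) (apex t) x * idist (region t) (apex t) y)))"

lemma angle_quot_params: "s \<in> {0<..a} \<Longrightarrow> r \<in> {0<..b} \<Longrightarrow> angle_quot (g s, h r) = arccos (cos_quot s r)"
  by (simp add: angle_quot_def cos_quot_def idist_apex_g idist_apex_h)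

lemma
  shows Limsup_angle_quot: "Limsup side_filter (\<lambda>z. ereal (angle_quot z)) = ereal (tri_angle t)"
    and tri_angle_nonneg: "0 \<le> tri_angle t" and tri_angle_le_pi: "tri_angle t \<le> pi"
proof -
  let ?L = "Limsup side_filter (\<lambda>z. ereal (angle_quot z))"
  have bnd: "0 \<le> angle_quot (g s, h r) \<and> angle_quot (g s, h r) \<le> pi" if "s \<in> {0<..a}" "r \<in> {0<..b}" for s r
    unfolding angle_quot_params[OF that]
    using cos_quot_bounds[OF that] by (intro conjI arccos_lbound arccos_ubound)
  have "?L \<le> ereal pi"
    by (rule Limsup_bounded, rule eventually_side_filterI) (use bnd in auto)
  moreover have "ereal 0 \<le> ?L"
    by (rule le_Limsup[OF side_filter_nontrivial], rule eventually_side_filterI) (use bnd in auto)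
  moreover have "tri_angle t = real_of_ereal ?L"
    by (simp add: tri_angle_def angle_quot_def Let_def case_prod_unfold)
  ultimately show "?L = ereal (tri_angle t)" "0 \<le> tri_angle t" "tri_angle t \<le> pi"
    by (cases ?L; simp)+
qed

text \<open>Being an upper limit, the angle bounds the distances between the sides from above by those in a
  Euclidean angle of the same size, up to an arbitrarily small change of the cosine. The first variation
  is built on this bound.\<close>
lemma idist_sides_le:
  assumes "0 < e"
  shows "\<exists>d>0. d \<le> a \<and> d \<le> b \<and> (\<forall>s r. 0 < s \<and> s < d \<and> 0 < r \<and> r < d \<longrightarrow>
       (idist (region t) (g s) (h r))\<^sup>2 \<le> s\<^sup>2 + r\<^sup>2 - 2 * s * r * (cos (tri_angle t) - e))"
proof -
  have "isCont cos (tri_angle t)"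
    by simp
  then obtain \<delta> where \<delta>: "0 < \<delta>" "\<And>x. \<bar>x - tri_angle t\<bar> < \<delta> \<Longrightarrow> \<bar>cos x - cos (tri_angle t)\<bar> < e"
    using assms unfolding continuous_at_eps_delta dist_real_def by blast
  have "Limsup side_filter (\<lambda>z. ereal (angle_quot z)) < ereal (tri_angle t + \<delta>)"
    using \<delta>(1) by (simp add: Limsup_angle_quot)
  then have "eventually (\<lambda>z. ereal (angle_quot z) < ereal (tri_angle t + \<delta>)) side_filter"
    by (rule Limsup_lessD)
  then obtain d where d: "0 < d" "d \<le> a" "d \<le> b"
    and lt: "\<forall>s r. 0 < s \<and> s < d \<and> 0 < r \<and> r < d \<longrightarrow>
      ereal (angle_quot (g s, h r)) < ereal (tri_angle t + \<delta>)"
    using eventually_side_filterD by blast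
  show ?thesis
  proof (intro exI[of _ d] conjI allI impI d)
    fix s r assume sr: "0 < s \<and> s < d \<and> 0 < r \<and> r < d"
    then have in_sides: "s \<in> {0<..a}" "r \<in> {0<..b}"
      using d by auto
    define x where "x = arccos (cos_quot s r)"
    have x: "0 \<le> x" "x \<le> pi" "cos x = cos_quot s r"
      using cos_quot_bounds[OF in_sides] by (simp_all add: x_def arccos_lbound arccos_ubound)
    have "x < tri_angle t + \<delta>"
      using lt[rule_format, OF sr] by (simp only: angle_quot_params[OF in_sides] x_def ereal_less_eq less_ereal.simps(1))
    have "cos (tri_angle t) - e \<le> cos x"
    proof (cases "x \<le> tri_angle t")
      case True
      then have "cos (tri_angle t) \<le> cos x"
        using x(1) tri_angle_le_pi by (intro cos_monotone_0_pi_le)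
      then show ?thesis using assms by simp
    next
      case False
      then show ?thesis
        using \<delta>(2)[of x] \<open>x < tri_angle t + \<delta>\<close> by (simp add: abs_less_iff)
    qed
    then have "(cos (tri_angle t) - e) * (2 * s * r) \<le> cos_quot s r * (2 * s * r)"
      using sr x(3) by (intro mult_right_mono) auto
    also have "\<dots> = s\<^sup>2 + r\<^sup>2 - (idist (region t) (g s) (h r))\<^sup>2"
      using sr by (simp add: cos_quot_def)
    finally show "(idist (region t) (g s) (h r))\<^sup>2 \<le> s\<^sup>2 + r\<^sup>2 - 2 * s * r * (cos (tri_angle t) - e)"
      by (simp add: algebra_simps)
  qed
qed

end

text \<open>If the angle were \<open>0\<close>, the two sides would be tangent at the apex, hence equal near it, whereas
  the sides of a triangle meet only at the apex.\<close>
lemma spherical_triangle_angle_pos: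
  assumes "0 < \<kappa>" and "triangle_on (model_sphere \<kappa>) t"
  shows "0 < tri_angle t"
proof (rule ccontr)
  define X where "X = model_sphere \<kappa>"
  define \<rho> where "\<rho> = 1 / sqrt \<kappa>"
  have "0 < \<rho>" and X: "X = sphere 0 \<rho>"
    using assms(1) by (simp_all add: \<rho>_def X_def model_sphere_def)
  define a where "a = idist X (apex t) (lvert t)"
  define b where "b = idist X (rvert t) (apex t)"
  obtain g h where "side_params t a b g h" and g: "unit_speed X a g" and h: "unit_speed X b h"
    and meet: "lside t \<inter> rside t = {apex t}"
    using triangle_on_side_params[OF assms(2)] unfolding a_def b_def X_def by metis
  then interpret parametrized_triangle t a b g h
    by unfold_locales
  assume "\<not> 0 < tri_angle t"
  then have angle: "tri_angle t = 0"
    using tri_angle_nonneg by simp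
  define s where "s = min (min a b) \<rho>"
  have s: "0 < s" "s \<le> a" "s \<le> b" "s \<le> \<rho>"
    using a_pos b_pos \<open>0 < \<rho>\<close> by (simp_all add: s_def)
  have "g s = h s"
  proof (rule sphere_arcs_tangent_eq[OF \<open>0 < \<rho>\<close> \<open>0 < s\<close>])
    have "\<rho> < \<rho> * pi"
      using \<open>0 < \<rho>\<close> pi_gt3 by simp
    then show "s < \<rho> * pi"
      using s by linarith
    show "norm (g r) = \<rho>" "norm (h r) = \<rho>" if "r \<in> {0..s}" for r
      using that s g h by (auto simp: X unit_speed_def image_subset_iff)
    show "inner_dist (sphere 0 \<rho>) (g r) (g q) = ennreal \<bar>r - q\<bar>"
      "inner_dist (sphere 0 \<rho>) (h r) (h q) = ennreal \<bar>r - q\<bar>" if "r \<in> {0..s}" "q \<in> {0..s}" for r q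
      using that s unit_speed_dist[OF g, of r q] unit_speed_dist[OF h, of r q] by (auto simp: X)
    show "g 0 = h 0"
      by (simp add: g_0 h_0)
    fix e d :: real assume "0 < e" "0 < d"
    then have "0 < e\<^sup>2 / 2"
      by simp
    then obtain \<delta> where \<delta>: "0 < \<delta>" "\<delta> \<le> a" "\<delta> \<le> b" and close: "\<forall>s r. 0 < s \<and> s < \<delta> \<and> 0 < r \<and> r < \<delta> \<longrightarrow>
       (idist (region t) (g s) (h r))\<^sup>2 \<le> s\<^sup>2 + r\<^sup>2 - 2 * s * r * (cos (tri_angle t) - e\<^sup>2 / 2)"
      using idist_sides_le by blast
    obtain r where r: "0 < r" "r < min d \<delta>"
      using \<open>0 < d\<close> \<open>0 < \<delta>\<close> dense[of 0 "min d \<delta>"] by auto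
    have "(idist (region t) (g r) (h r))\<^sup>2 \<le> (e * r)\<^sup>2"
      using close[rule_format, of r r] r by (simp add: angle power2_eq_square algebra_simps)
    then have "idist (region t) (g r) (h r) \<le> e * r"
      by (rule power2_le_imp_le) (use \<open>0 < e\<close> r(1) in auto)
    moreover have "dist (g r) (h r) \<le> idist (region t) (g r) (h r)"
    proof -
      have "inner_dist (region t) (g r) (h r) = ennreal (idist (region t) (g r) (h r))"
        using r \<delta> by (intro inner_dist_sides(1)) auto
      then show ?thesis
        using dist_le_inner_dist[of "g r" "h r" "region t"] idist_nonneg[of "region t" "g r" "h r"]
        by (simp add: ennreal_le_iff)
    qed
    ultimately show "\<exists>r. 0 < r \<and> r < d \<and> dist (g r) (h r) \<le> e * r"
      using r by auto
  qed
  moreover have "g s \<in> lside t" "h s \<in> rside t"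
    using s g_image h_image by auto
  ultimately have "g s = apex t"
    using meet by auto
  then have "idist (region t) (apex t) (apex t) = s"
    using idist_apex_g[of s] s by simp
  moreover have "apex t \<in> region t"
    using g_in[of 0] a_pos g_0 by simp
  ultimately show False
    using s(1) by (simp add: idist_def inner_dist_refl)
qed

section \<open>Distances in the glued manifold\<close>

lemma glue_rel_refl: "(z, z) \<in> glue_rel t"
  by (simp add: glue_rel_def)

lemma glue_rel_sym: "(y, z) \<in> glue_rel t \<Longrightarrow> (z, y) \<in> glue_rel t"
  using sym_rtrancl[OF sym_Un_converse[of "side_identification t"]] unfolding glue_rel_def by (rule symD)

lemma glue_rel_trans: "(x, y) \<in> glue_rel t \<Longrightarrow> (y, z) \<in> glue_rel t \<Longrightarrow> (x, z) \<in> glue_rel t"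
  unfolding glue_rel_def by (rule rtrancl_trans)

lemma mem_gclass: "z \<in> gclass t k x \<longleftrightarrow> ((k, x), z) \<in> glue_rel t"
  by (simp add: gclass_def)

lemma gclass_eqI: "((k, x), (l, y)) \<in> glue_rel t \<Longrightarrow> gclass t k x = gclass t l y"
  unfolding gclass_def using glue_rel_sym glue_rel_trans by blast

definition chain_length :: "(vertex \<Rightarrow> tri) \<Rightarrow> (vertex \<times> point \<times> point) list \<Rightarrow> ennreal" where
  "chain_length t cs = (\<Sum>(k, x, y) \<leftarrow> cs. inner_dist (region (t k)) x y)"

text \<open>The bound \<open>0 \<le> L\<close> is part of the definition because \<open>ennreal\<close> maps negative numbers to \<open>0\<close>.\<close>
definition joined_within ::
  "(vertex \<Rightarrow> tri) \<Rightarrow> (vertex \<times> point) set \<Rightarrow> (vertex \<times> point) set \<Rightarrow> real \<Rightarrow> bool" where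
  "joined_within t p q L \<longleftrightarrow> 0 \<le> L \<and> (\<exists>cs. glue_chain t p q cs \<and> chain_length t cs \<le> ennreal L)"

lemma joined_within_mono: "joined_within t p q L \<Longrightarrow> L \<le> L' \<Longrightarrow> joined_within t p q L'"
  unfolding joined_within_def by (meson ennreal_leI order_trans)

lemma joined_within_step:
  assumes "x \<in> region (t k)" "y \<in> region (t k)" "inner_dist (region (t k)) x y \<le> ennreal L" "0 \<le> L"
  shows "joined_within t (gclass t k x) (gclass t k y) L"
  unfolding joined_within_def
proof (intro conjI exI)
  show "glue_chain t (gclass t k x) (gclass t k y) [(k, x, y)]"
    using assms by (simp add: glue_chain_def mem_gclass glue_rel_refl)
qed (use assms in \<open>simp_all add: chain_length_def\<close>)

lemma glue_chain_append:
  assumes c: "glue_chain t p (gclass t k z) cs" and d: "glue_chain t (gclass t k z) q ds"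
  shows "glue_chain t p q (cs @ ds)"
  unfolding glue_chain_def
proof (intro conjI allI impI)
  have ne: "cs \<noteq> []" "ds \<noteq> []"
    using c d by (simp_all add: glue_chain_def)
  then show "cs @ ds \<noteq> []" by simp
  show "\<forall>(k, x, y)\<in>set (cs @ ds). x \<in> region (t k) \<and> y \<in> region (t k)"
    using c d by (auto simp: glue_chain_def)
  show "case hd (cs @ ds) of (k, x, y) \<Rightarrow> (k, x) \<in> p"
    using c ne by (simp add: glue_chain_def)
  show "case last (cs @ ds) of (k, x, y) \<Rightarrow> (k, y) \<in> q"
    using d ne by (simp add: glue_chain_def)
  let ?link = "\<lambda>a b. case (a, b) of ((k, x, y), (k', x', y')) \<Rightarrow> ((k, y), (k', x')) \<in> glue_rel t"
  have "((k, z), (fst (last cs), snd (snd (last cs)))) \<in> glue_rel t"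
    "((k, z), (fst (hd ds), fst (snd (hd ds)))) \<in> glue_rel t"
    using c d unfolding glue_chain_def mem_gclass by (simp_all add: case_prod_unfold)
  then have "((fst (last cs), snd (snd (last cs))), (fst (hd ds), fst (snd (hd ds)))) \<in> glue_rel t"
    by (rule glue_rel_trans[OF glue_rel_sym])
  then have mid: "?link (last cs) (hd ds)"
    by (simp add: case_prod_unfold)
  fix i assume i: "Suc i < length (cs @ ds)"
  consider "Suc i < length cs" | "Suc i = length cs" | "length cs \<le> i"
    by linarith
  then show "?link ((cs @ ds) ! i) ((cs @ ds) ! Suc i)"
  proof cases
    case 1
    then show ?thesis
      using c by (simp add: glue_chain_def nth_append)
  next
    case 2
    then have "(cs @ ds) ! i = last cs" "(cs @ ds) ! Suc i = hd ds"
      using ne by (simp_all add: nth_append last_conv_nth hd_conv_nth flip: 2)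
    then show ?thesis
      using mid by simp
  next
    case 3
    then obtain j where "i = length cs + j"
      using le_Suc_ex by blast
    then show ?thesis
      using d i by (simp add: glue_chain_def nth_append)
  qed
qed

lemma joined_within_trans:
  assumes "joined_within t p (gclass t k z) L" and "joined_within t (gclass t k z) q L'"
  shows "joined_within t p q (L + L')"
proof -
  obtain cs ds where "glue_chain t p (gclass t k z) cs" "glue_chain t (gclass t k z) q ds"
    and len: "chain_length t cs \<le> ennreal L" "chain_length t ds \<le> ennreal L'"
    using assms unfolding joined_within_def by blast
  then have "glue_chain t p q (cs @ ds)"
    by (blast intro: glue_chain_append)
  moreover have "chain_length t (cs @ ds) \<le> ennreal (L + L')"
    using add_mono[OF len] assms by (simp add: chain_length_def joined_within_def)
  ultimately show ?thesis
    using assms unfolding joined_within_def by auto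
qed

lemma gdist_alt: "gdist t p q = enn2real (INF cs \<in> {cs. glue_chain t p q cs}. chain_length t cs)"
  by (simp add: gdist_def chain_length_def)

lemma gdist_le: "joined_within t p q L \<Longrightarrow> gdist t p q \<le> L"
  unfolding gdist_alt joined_within_def by (auto intro!: enn2real_leI INF_lower2)

lemma gdist_ge:
  assumes "joined_within t p q L" and "\<And>cs. glue_chain t p q cs \<Longrightarrow> ennreal l \<le> chain_length t cs"
    and "0 \<le> l"
  shows "l \<le> gdist t p q"
proof -
  let ?I = "INF cs \<in> {cs. glue_chain t p q cs}. chain_length t cs"
  have "?I \<le> ennreal L"
    using assms(1) unfolding joined_within_def by (auto intro: INF_lower2)
  then have "?I < top"
    by (metis ennreal_less_top le_less_trans)
  moreover have "ennreal l \<le> ?I"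
    using assms(2) by (auto intro: INF_greatest)
  ultimately have "enn2real (ennreal l) \<le> enn2real ?I"
    by (intro enn2real_mono)
  then show ?thesis
    using assms(3) by (simp add: gdist_alt)
qed

text \<open>The distance to the apex in each triangle is compatible with the gluing, because the common
  sides are glued by this distance. It is thus a \<open>1\<close>-Lipschitz function on the glued manifold.\<close>
definition apex_dist :: "(vertex \<Rightarrow> tri) \<Rightarrow> vertex \<times> point \<Rightarrow> ennreal" where
  "apex_dist t = (\<lambda>(k, x). inner_dist (region (t k)) (apex (t k)) x)"

lemma apex_dist_glue: "(y, z) \<in> glue_rel t \<Longrightarrow> apex_dist t y = apex_dist t z"
  unfolding glue_rel_def
proof (induction rule: rtrancl_induct)
  case (step y z)
  then show ?case
    by (auto simp: side_identification_def apex_dist_def)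
qed simp

lemma apex_dist_chain:
  assumes "cs \<noteq> []"
    and "\<And>i. Suc i < length cs \<Longrightarrow> ((fst (cs ! i), snd (snd (cs ! i))),
        (fst (cs ! Suc i), fst (snd (cs ! Suc i)))) \<in> glue_rel t"
  shows "apex_dist t (fst (last cs), snd (snd (last cs)))
    \<le> apex_dist t (fst (hd cs), fst (snd (hd cs))) + chain_length t cs"
  using assms
proof (induction cs rule: list_nonempty_induct)
  case (single c)
  then show ?case
    by (cases c) (simp add: apex_dist_def chain_length_def inner_dist_triangle)
next
  case (cons c cs)
  have "apex_dist t (fst (last cs), snd (snd (last cs)))
      \<le> apex_dist t (fst (hd cs), fst (snd (hd cs))) + chain_length t cs"
  proof (rule cons.IH)
    fix i assume "Suc i < length cs"
    then show "((fst (cs ! i), snd (snd (cs ! i))), (fst (cs ! Suc i), fst (snd (cs ! Suc i)))) \<in> glue_rel t"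
      using cons.prems[of "Suc i"] by simp
  qed
  also have "apex_dist t (fst (hd cs), fst (snd (hd cs))) = apex_dist t (fst c, snd (snd c))"
    using cons.prems[of 0] cons.hyps by (intro apex_dist_glue[symmetric]) (simp add: hd_conv_nth)
  also have "\<dots> \<le> apex_dist t (fst c, fst (snd c)) + inner_dist (region (t (fst c))) (fst (snd c)) (snd (snd c))"
    by (simp add: apex_dist_def inner_dist_triangle)
  finally show ?case
    using cons.hyps by (simp add: chain_length_def case_prod_unfold add_ac)
qed

text \<open>The side of length \<open>len k\<close> at \<open>k\<close> is the left side of the triangle \<open>k\<close> and the right side of the
  preceding one; giving both the same length makes the gluing by length match their end points.\<close>
locale glued_triangles =
  fixes t :: "vertex \<Rightarrow> tri" and len :: "vertex \<Rightarrow> real" and g h :: "vertex \<Rightarrow> real \<Rightarrow> point"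
  assumes side_params: "side_params (t k) (len k) (len (nxt k)) (g k) (h k)"
begin

sublocale tri: parametrized_triangle "t k" "len k" "len (nxt k)" "g k" "h k" for k
  by unfold_locales (rule side_params)

definition on_side :: "vertex \<Rightarrow> real \<Rightarrow> (vertex \<times> point) set" where
  "on_side R s = gclass t R (g R s)"

lemma on_side_nxt:
  assumes "s \<in> {0..len (nxt k)}"
  shows "on_side (nxt k) s = gclass t k (h k s)"
proof -
  have "((k, h k s), (nxt k, g (nxt k) s)) \<in> side_identification t"
    unfolding side_identification_def
    using assms tri.h_image[of k] tri.g_image[of "nxt k"] tri.inner_dist_apex_g[OF assms]
      tri.inner_dist_apex_h[OF assms] by auto
  then show ?thesis
    unfolding on_side_def by (intro gclass_eqI[symmetric]) (auto simp: glue_rel_def)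
qed

lemma gP_eq: "gP t = on_side k 0"
proof -
  have step: "on_side (nxt k) 0 = on_side k 0" for k
    using on_side_nxt[of 0 k] tri.b_pos[of k] by (simp add: on_side_def tri.h_0 tri.g_0)
  have "gP t = on_side vA 0"
    by (simp add: gP_def on_side_def tri.g_0)
  then show ?thesis
    using step[of vA] step[of vD] step[of vC] by (cases k) simp_all
qed

lemma gvert_eq: "gvert t R = on_side R (len R)"
  by (simp add: gvert_def on_side_def tri.g_a)

lemma on_side_in_glued: "s \<in> {0..len R} \<Longrightarrow> on_side R s \<in> glued t"
  unfolding on_side_def glued_def gclass_def
  by (rule quotientI) (cases R; simp add: glue_points_def vertices_def tri.g_in)

lemma joined_on_side:
  assumes "s \<in> {0..len R}" and "r \<in> {0..len R}"
  shows "joined_within t (on_side R s) (on_side R r) \<bar>s - r\<bar>"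
  unfolding on_side_def
  using assms by (intro joined_within_step) (simp_all add: tri.g_in unit_speed_dist[OF tri.g_unit])

lemma joined_gvert: "s \<in> {0..len R} \<Longrightarrow> joined_within t (on_side R s) (gvert t R) (len R - s)"
  using joined_on_side[of s R "len R"] tri.a_pos[of R] by (simp add: gvert_eq)

text \<open>Gluing does not shorten the sides: \<open>apex_dist\<close> vanishes at the common vertex and is \<open>len R\<close> at \<open>R\<close>,
  so every chain between the two is at least that long.\<close>
lemma gdist_gP_gvert: "gdist t (gP t) (gvert t R) = len R"
proof (rule antisym)
  have joined: "joined_within t (gP t) (gvert t R) (len R)"
    using joined_gvert[of 0 R] tri.a_pos[of R] by (simp add: gP_eq[of R])
  then show "gdist t (gP t) (gvert t R) \<le> len R"
    by (rule gdist_le)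
  show "len R \<le> gdist t (gP t) (gvert t R)"
  proof (rule gdist_ge[OF joined])
    show "0 \<le> len R"
      using tri.a_pos[of R] by simp
    fix cs assume cs: "glue_chain t (gP t) (gvert t R) cs"
    then have start: "(fst (hd cs), fst (snd (hd cs))) \<in> gP t"
      and stop: "(fst (last cs), snd (snd (last cs))) \<in> gvert t R" and "cs \<noteq> []"
      unfolding glue_chain_def by (simp_all add: case_prod_unfold)
    have "apex_dist t (fst (hd cs), fst (snd (hd cs))) = apex_dist t (vA, apex (t vA))"
      using start by (intro apex_dist_glue[symmetric]) (simp add: gP_def mem_gclass)
    also have "\<dots> = 0"
      using tri.inner_dist_apex_g[where k=vA and s=0] tri.a_pos[of vA] by (simp add: apex_dist_def tri.g_0)
    finally have 1: "apex_dist t (fst (hd cs), fst (snd (hd cs))) = 0" .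
    have "apex_dist t (fst (last cs), snd (snd (last cs))) = apex_dist t (R, lvert (t R))"
      using stop by (intro apex_dist_glue[symmetric]) (simp add: gvert_def mem_gclass)
    also have "\<dots> = ennreal (len R)"
      using tri.inner_dist_apex_g[where k=R and s="len R"] tri.a_pos[of R] by (simp add: apex_dist_def tri.g_a)
    finally have 2: "apex_dist t (fst (last cs), snd (snd (last cs))) = ennreal (len R)" .
    have "apex_dist t (fst (last cs), snd (snd (last cs)))
        \<le> apex_dist t (fst (hd cs), fst (snd (hd cs))) + chain_length t cs"
      using cs unfolding glue_chain_def by (intro apex_dist_chain) (auto simp: case_prod_unfold)
    then show "ennreal (len R) \<le> chain_length t cs"
      by (simp add: 1 2)
  qed
qed

section \<open>The first variation of the distance from a vertex\<close>

text \<open>When the point leaves the common vertex along the side \<open>R\<close>, its distance from the vertex \<open>S\<close>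
  decreases at a rate of at least \<open>c\<close>. For \<open>c\<close> the cosine of the angle between the sides, this is the
  upper half of the first variation formula.\<close>
definition descends :: "vertex \<Rightarrow> vertex \<Rightarrow> real \<Rightarrow> bool" where
  "descends R S c \<longleftrightarrow> (\<forall>e>0. \<exists>d>0. \<forall>s. 0 < s \<and> s < d \<longrightarrow>
     joined_within t (on_side R s) (gvert t S) (len S - s * (c - e)))"

text \<open>Near the common vertex the points of the sides \<open>R\<close> and \<open>S\<close> are, to first order, no farther apart than
  in a Euclidean angle with cosine \<open>c\<close>. Asking for both directions makes the notion symmetric.\<close>
definition wedge :: "vertex \<Rightarrow> vertex \<Rightarrow> real \<Rightarrow> bool" where
  "wedge R S c \<longleftrightarrow> (\<forall>e>0. \<exists>d>0. \<forall>s r. 0 < s \<and> s < d \<and> 0 < r \<and> r < d \<longrightarrow>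
     (\<exists>L. joined_within t (on_side R s) (on_side S r) L \<and> joined_within t (on_side S r) (on_side R s) L \<and>
          L\<^sup>2 \<le> s\<^sup>2 + r\<^sup>2 - 2 * s * r * (c - e)))"

lemma wedgeD:
  assumes "wedge R S c" and "0 < e"
  shows "\<exists>d>0. \<forall>s r. 0 < s \<and> s < d \<and> 0 < r \<and> r < d \<longrightarrow>
     (\<exists>L. joined_within t (on_side R s) (on_side S r) L \<and> L\<^sup>2 \<le> s\<^sup>2 + r\<^sup>2 - 2 * s * r * (c - e))"
proof -
  obtain d where "0 < d" and d: "\<forall>s r. 0 < s \<and> s < d \<and> 0 < r \<and> r < d \<longrightarrow>
     (\<exists>L. joined_within t (on_side R s) (on_side S r) L \<and> joined_within t (on_side S r) (on_side R s) L \<and>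
          L\<^sup>2 \<le> s\<^sup>2 + r\<^sup>2 - 2 * s * r * (c - e))"
    using assms unfolding wedge_def by blast
  then show ?thesis by (intro exI[of _ d] conjI) blast+
qed

lemma wedge_sym:
  assumes "wedge R S c"
  shows "wedge S R c"
  unfolding wedge_def
proof (intro allI impI)
  fix e :: real assume "0 < e"
  then obtain d where "0 < d" and d: "\<forall>s r. 0 < s \<and> s < d \<and> 0 < r \<and> r < d \<longrightarrow>
     (\<exists>L. joined_within t (on_side R s) (on_side S r) L \<and> joined_within t (on_side S r) (on_side R s) L \<and>
          L\<^sup>2 \<le> s\<^sup>2 + r\<^sup>2 - 2 * s * r * (c - e))"
    using assms unfolding wedge_def by blast
  show "\<exists>d>0. \<forall>s r. 0 < s \<and> s < d \<and> 0 < r \<and> r < d \<longrightarrow>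
     (\<exists>L. joined_within t (on_side S s) (on_side R r) L \<and> joined_within t (on_side R r) (on_side S s) L \<and>
          L\<^sup>2 \<le> s\<^sup>2 + r\<^sup>2 - 2 * s * r * (c - e))"
  proof (rule exI[of _ d], intro conjI allI impI \<open>0 < d\<close>)
    fix s r assume "0 < s \<and> s < d \<and> 0 < r \<and> r < d"
    then obtain L where "joined_within t (on_side R r) (on_side S s) L" "joined_within t (on_side S s) (on_side R r) L"
      and "L\<^sup>2 \<le> r\<^sup>2 + s\<^sup>2 - 2 * r * s * (c - e)"
      using d by blast
    moreover have "r\<^sup>2 + s\<^sup>2 - 2 * r * s * (c - e) = s\<^sup>2 + r\<^sup>2 - 2 * s * r * (c - e)"
      by simp
    ultimately show "\<exists>L. joined_within t (on_side S s) (on_side R r) L \<and>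
        joined_within t (on_side R r) (on_side S s) L \<and> L\<^sup>2 \<le> s\<^sup>2 + r\<^sup>2 - 2 * s * r * (c - e)"
      by metis
  qed
qed

lemma wedge_nxt: "wedge k (nxt k) (cos (tri_angle (t k)))"
  unfolding wedge_def
proof (intro allI impI)
  fix e :: real assume e: "0 < e"
  obtain d where d: "0 < d" "d \<le> len k" "d \<le> len (nxt k)"
    and le: "\<forall>s r. 0 < s \<and> s < d \<and> 0 < r \<and> r < d \<longrightarrow>
     (idist (region (t k)) (g k s) (h k r))\<^sup>2 \<le> s\<^sup>2 + r\<^sup>2 - 2 * s * r * (cos (tri_angle (t k)) - e)"
    using tri.idist_sides_le[OF e] by blast
  show "\<exists>d>0. \<forall>s r. 0 < s \<and> s < d \<and> 0 < r \<and> r < d \<longrightarrow>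
     (\<exists>L. joined_within t (on_side k s) (on_side (nxt k) r) L \<and>
          joined_within t (on_side (nxt k) r) (on_side k s) L \<and>
          L\<^sup>2 \<le> s\<^sup>2 + r\<^sup>2 - 2 * s * r * (cos (tri_angle (t k)) - e))"
  proof (rule exI[of _ d], intro conjI allI impI d(1))
    fix s r assume sr: "0 < s \<and> s < d \<and> 0 < r \<and> r < d"
    then have sides: "s \<in> {0..len k}" "r \<in> {0..len (nxt k)}"
      using d by auto
    let ?L = "idist (region (t k)) (g k s) (h k r)"
    have "inner_dist (region (t k)) (g k s) (h k r) \<le> ennreal ?L"
      using tri.inner_dist_sides(1)[OF sides] by simp
    then have "joined_within t (on_side k s) (on_side (nxt k) r) ?L"
      "joined_within t (on_side (nxt k) r) (on_side k s) ?L"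
      unfolding on_side_nxt[OF sides(2)] on_side_def[of k]
      using sides inner_dist_commute[of "region (t k)" "h k r" "g k s"]
      by (auto intro!: joined_within_step tri.g_in tri.h_in idist_nonneg)
    then show "\<exists>L. joined_within t (on_side k s) (on_side (nxt k) r) L \<and>
        joined_within t (on_side (nxt k) r) (on_side k s) L \<and>
        L\<^sup>2 \<le> s\<^sup>2 + r\<^sup>2 - 2 * s * r * (cos (tri_angle (t k)) - e)"
      using le sr by blast
  qed
qed

lemma descends_self: "descends R R 1"
  unfolding descends_def
proof (intro allI impI)
  fix e :: real assume "0 < e"
  show "\<exists>d>0. \<forall>s. 0 < s \<and> s < d \<longrightarrow> joined_within t (on_side R s) (gvert t R) (len R - s * (1 - e))"
  proof (intro exI[of _ "len R"] conjI allI impI)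
    fix s assume s: "0 < s \<and> s < len R"
    then have "joined_within t (on_side R s) (gvert t R) (len R - s)"
      by (intro joined_gvert) simp
    moreover have "len R - s \<le> len R - s * (1 - e)"
      using s \<open>0 < e\<close> by (simp add: algebra_simps)
    ultimately show "joined_within t (on_side R s) (gvert t R) (len R - s * (1 - e))"
      by (rule joined_within_mono)
  qed (rule tri.a_pos)
qed

text \<open>The detour through the common vertex serves for sides that include a straight angle.\<close>
lemma descends_through_gP: "descends R S (-1)"
  unfolding descends_def
proof (intro allI impI)
  fix e :: real assume "0 < e"
  show "\<exists>d>0. \<forall>s. 0 < s \<and> s < d \<longrightarrow> joined_within t (on_side R s) (gvert t S) (len S - s * (-1 - e))"
  proof (intro exI[of _ "len R"] conjI allI impI)
    fix s assume s: "0 < s \<and> s < len R"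
    have "joined_within t (on_side R s) (gclass t S (g S 0)) s"
      using joined_on_side[of s R 0] s gP_eq[of R] gP_eq[of S] by (simp add: on_side_def)
    moreover have "joined_within t (gclass t S (g S 0)) (gvert t S) (len S)"
      using joined_gvert[of 0 S] tri.a_pos[of S] by (simp add: on_side_def)
    ultimately have "joined_within t (on_side R s) (gvert t S) (s + len S)"
      by (rule joined_within_trans)
    moreover have "s + len S \<le> len S - s * (-1 - e)"
      using s \<open>0 < e\<close> by (simp add: algebra_simps)
    ultimately show "joined_within t (on_side R s) (gvert t S) (len S - s * (-1 - e))"
      by (rule joined_within_mono)
  qed (rule tri.a_pos)
qed

lemma joined_via_side:
  assumes "joined_within t p (on_side S r) L" and "joined_within t (on_side S r) q L'"
  shows "joined_within t p q (L + L')"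
  using assms unfolding on_side_def by (rule joined_within_trans)

text \<open>The path from the point at \<open>s\<close> leads to the much farther point at \<open>r = 3 * s / e\<close> on the next
  side; from there on the distance decreases at full rate. The length of the first step is
  \<open>r - s * c\<close> up to the second-order term \<open>s\<^sup>2 / (2 * r)\<close>, which the factor \<open>3 / e\<close> makes small
  compared with \<open>s * e\<close>.\<close>
lemma descends_wedge:
  assumes wedge: "wedge R S c" and desc: "descends S T 1"
  shows "descends R T c"
  unfolding descends_def
proof (intro allI impI)
  fix e :: real assume "0 < e"
  define N where "N = 3 / e"
  have N: "0 < N" "1 / (2 * N) \<le> e / 3" "N * (e\<^sup>2 / 9) = e / 3"
    using \<open>0 < e\<close> by (simp_all add: N_def power2_eq_square)
  have "0 < e / 3" "0 < e\<^sup>2 / 9"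
    using \<open>0 < e\<close> by simp_all
  obtain d1 where "0 < d1" and d1: "\<forall>s r. 0 < s \<and> s < d1 \<and> 0 < r \<and> r < d1 \<longrightarrow>
     (\<exists>L. joined_within t (on_side R s) (on_side S r) L \<and> L\<^sup>2 \<le> s\<^sup>2 + r\<^sup>2 - 2 * s * r * (c - e / 3))"
    using wedgeD[OF wedge \<open>0 < e / 3\<close>] by blast
  obtain d2 where "0 < d2" and d2: "\<forall>s. 0 < s \<and> s < d2 \<longrightarrow>
     joined_within t (on_side S s) (gvert t T) (len T - s * (1 - e\<^sup>2 / 9))"
    using desc \<open>0 < e\<^sup>2 / 9\<close> unfolding descends_def by blast
  define d where "d = min (min d1 (d1 / N)) (d2 / N)"
  show "\<exists>d>0. \<forall>s. 0 < s \<and> s < d \<longrightarrow> joined_within t (on_side R s) (gvert t T) (len T - s * (c - e))"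
  proof (intro exI[of _ d] conjI allI impI)
    show "0 < d"
      using \<open>0 < d1\<close> \<open>0 < d2\<close> N(1) by (simp add: d_def)
    fix s assume s: "0 < s \<and> s < d"
    define r where "r = s * N"
    have r: "0 < r" "r < d1" "r < d2" "s < d1"
      using s N(1) by (simp_all add: r_def d_def field_simps)
    obtain L where L: "joined_within t (on_side R s) (on_side S r) L"
      and L2: "L\<^sup>2 \<le> s\<^sup>2 + r\<^sup>2 - 2 * s * r * (c - e / 3)"
      using d1 s r by blast
    have "joined_within t (on_side S r) (gvert t T) (len T - r * (1 - e\<^sup>2 / 9))"
      using d2 r by blast
    then have joined: "joined_within t (on_side R s) (gvert t T) (L + (len T - r * (1 - e\<^sup>2 / 9)))"
      by (rule joined_via_side[OF L])
    (* This square replaces the expansion of the root in the bound for L. *)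
    have "0 \<le> (L - r)\<^sup>2"
      by simp
    then have "2 * (r * L) \<le> 2 * r\<^sup>2 + s\<^sup>2 - 2 * s * r * (c - e / 3)"
      using L2 by (simp add: power2_eq_square algebra_simps)
    also have "\<dots> = 2 * (r * (r - s * (c - e / 3) + s * (1 / (2 * N))))"
      using N(1) by (simp add: r_def power2_eq_square field_simps)
    finally have "L \<le> r - s * (c - e / 3) + s * (1 / (2 * N))"
      using r(1) by simp
    also have "\<dots> \<le> r - s * (c - e / 3) + s * (e / 3)"
      using s N(2) by (intro add_left_mono mult_left_mono) auto
    finally have "L + (len T - r * (1 - e\<^sup>2 / 9)) \<le> len T - s * (c - e / 3) + s * (e / 3) + r * (e\<^sup>2 / 9)"
      by (simp add: algebra_simps)
    also have "r * (e\<^sup>2 / 9) = s * (e / 3)"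
      using N(3) by (simp add: r_def mult.assoc)
    also have "len T - s * (c - e / 3) + s * (e / 3) + s * (e / 3) = len T - s * (c - e)"
      by (simp add: algebra_simps)
    finally show "joined_within t (on_side R s) (gvert t T) (len T - s * (c - e))"
      by (rule joined_within_mono[OF joined])
  qed
qed

lemma descends_adjacent: "wedge R S c \<Longrightarrow> descends R S c"
  by (rule descends_wedge[OF _ descends_self])

text \<open>In the plane, the line through the point at \<open>s\<close> parallel to the direction of \<open>T\<close> meets the
  intermediate ray at \<open>s * sin (\<alpha> + \<beta>) / sin \<beta>\<close>, by the law of sines. The path follows this line
  up to the intermediate side and continues as \<open>desc\<close> allows; its parallelism to the direction of \<open>T\<close>
  makes the two rates add up to \<open>cos (\<alpha> + \<beta>)\<close>.\<close>
lemma descends_two_wedges: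
  assumes wedge: "wedge R S (cos \<alpha>)" and desc: "descends S T (cos \<beta>)"
    and "0 \<le> \<alpha>" "0 \<le> \<beta>" "\<alpha> + \<beta> < pi"
  shows "descends R T (cos (\<alpha> + \<beta>))"
proof (cases "\<beta> = 0")
  case True
  then show ?thesis
    using descends_wedge[OF wedge] desc by simp
next
  case False
  have pos: "0 < sin \<beta>" "0 < sin (\<alpha> + \<beta>)" "0 \<le> sin \<alpha>"
    using assms(3-5) False by (auto intro!: sin_gt_zero sin_ge_zero)
  define \<rho> where "\<rho> = sin (\<alpha> + \<beta>) / sin \<beta>"
  define \<sigma> where "\<sigma> = sin \<alpha> / sin \<beta>"
  have "0 < \<rho>" "0 \<le> \<sigma>"
    using pos by (simp_all add: \<rho>_def \<sigma>_def)
  have law_of_cosines: "1 + \<rho>\<^sup>2 - 2 * \<rho> * cos \<alpha> = \<sigma>\<^sup>2"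
  proof -
    have "(sin \<beta>)\<^sup>2 + (sin (\<alpha> + \<beta>))\<^sup>2 - 2 * sin (\<alpha> + \<beta>) * sin \<beta> * cos \<alpha> = (sin \<alpha>)\<^sup>2"
      unfolding sin_add using sin_cos_squared_add[of \<alpha>] sin_cos_squared_add[of \<beta>] by algebra
    then have "((sin \<beta>)\<^sup>2 + (sin (\<alpha> + \<beta>))\<^sup>2 - 2 * sin (\<alpha> + \<beta>) * sin \<beta> * cos \<alpha>) / (sin \<beta>)\<^sup>2
        = (sin \<alpha>)\<^sup>2 / (sin \<beta>)\<^sup>2"
      by simp
    then show ?thesis
      using pos(1) by (simp add: \<rho>_def \<sigma>_def power_divide add_divide_distrib diff_divide_distrib
          power2_eq_square)
  qed
  have slope: "\<rho> * cos \<beta> - \<sigma> = cos (\<alpha> + \<beta>)"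
  proof -
    have "sin (\<alpha> + \<beta>) * cos \<beta> - sin \<alpha> = cos (\<alpha> + \<beta>) * sin \<beta>"
      unfolding sin_add cos_add using sin_cos_squared_add[of \<alpha>] sin_cos_squared_add[of \<beta>] by algebra
    then show ?thesis
      using pos(1) by (simp add: \<rho>_def \<sigma>_def field_simps)
  qed
  show ?thesis
    unfolding descends_def
  proof (intro allI impI)
    fix e :: real assume "0 < e"
    have "0 < e\<^sup>2 / (8 * \<rho>)" "0 < e / (2 * \<rho>)"
      using \<open>0 < e\<close> \<open>0 < \<rho>\<close> by simp_all
    obtain d1 where "0 < d1" and d1: "\<forall>s r. 0 < s \<and> s < d1 \<and> 0 < r \<and> r < d1 \<longrightarrow>
       (\<exists>L. joined_within t (on_side R s) (on_side S r) L \<and>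
            L\<^sup>2 \<le> s\<^sup>2 + r\<^sup>2 - 2 * s * r * (cos \<alpha> - e\<^sup>2 / (8 * \<rho>)))"
      using wedgeD[OF wedge \<open>0 < e\<^sup>2 / (8 * \<rho>)\<close>] by blast
    obtain d2 where "0 < d2" and d2: "\<forall>s. 0 < s \<and> s < d2 \<longrightarrow>
       joined_within t (on_side S s) (gvert t T) (len T - s * (cos \<beta> - e / (2 * \<rho>)))"
      using desc \<open>0 < e / (2 * \<rho>)\<close> unfolding descends_def by blast
    define d where "d = min (min d1 (d1 / \<rho>)) (d2 / \<rho>)"
    show "\<exists>d>0. \<forall>s. 0 < s \<and> s < d \<longrightarrow>
        joined_within t (on_side R s) (gvert t T) (len T - s * (cos (\<alpha> + \<beta>) - e))"
    proof (intro exI[of _ d] conjI allI impI)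
      show "0 < d"
        using \<open>0 < d1\<close> \<open>0 < d2\<close> \<open>0 < \<rho>\<close> by (simp add: d_def)
      fix s assume s: "0 < s \<and> s < d"
      define r where "r = s * \<rho>"
      have r: "0 < r" "r < d1" "r < d2" "s < d1"
        using s \<open>0 < \<rho>\<close> by (simp_all add: r_def d_def field_simps)
      obtain L where L: "joined_within t (on_side R s) (on_side S r) L"
        and L2: "L\<^sup>2 \<le> s\<^sup>2 + r\<^sup>2 - 2 * s * r * (cos \<alpha> - e\<^sup>2 / (8 * \<rho>))"
        using d1 s r by blast
      have "joined_within t (on_side S r) (gvert t T) (len T - r * (cos \<beta> - e / (2 * \<rho>)))"
        using d2 r by blast
      then have joined: "joined_within t (on_side R s) (gvert t T)
          (L + (len T - r * (cos \<beta> - e / (2 * \<rho>))))"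
        by (rule joined_via_side[OF L])
      have "s\<^sup>2 + r\<^sup>2 - 2 * s * r * (cos \<alpha> - e\<^sup>2 / (8 * \<rho>))
          = s\<^sup>2 * (1 + \<rho>\<^sup>2 - 2 * \<rho> * cos \<alpha> + (e / 2)\<^sup>2)"
        using \<open>0 < \<rho>\<close> by (simp add: r_def power2_eq_square field_simps)
      also have "\<dots> \<le> s\<^sup>2 * (\<sigma> + e / 2)\<^sup>2"
        unfolding law_of_cosines using \<open>0 \<le> \<sigma>\<close> \<open>0 < e\<close>
        by (intro mult_left_mono) (simp_all add: power2_sum)
      finally have "L\<^sup>2 \<le> (s * (\<sigma> + e / 2))\<^sup>2"
        using L2 by (simp add: power_mult_distrib)
      then have "L \<le> s * (\<sigma> + e / 2)"
        by (rule power2_le_imp_le) (use s \<open>0 \<le> \<sigma>\<close> \<open>0 < e\<close> in auto)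
      then have "L + (len T - r * (cos \<beta> - e / (2 * \<rho>)))
          \<le> s * (\<sigma> + e / 2) + (len T - r * (cos \<beta> - e / (2 * \<rho>)))"
        by simp
      also have "\<dots> = len T - s * (cos (\<alpha> + \<beta>) - e)"
        unfolding slope[symmetric] r_def using \<open>0 < \<rho>\<close> by (simp add: field_simps)
      finally show "joined_within t (on_side R s) (gvert t T) (len T - s * (cos (\<alpha> + \<beta>) - e))"
        by (rule joined_within_mono[OF joined])
    qed
  qed
qed

text \<open>Of the two ways around the common vertex, at least one makes an angle of at most \<open>\<pi>\<close>.\<close>
lemma descends_opposite:
  assumes "wedge R S (cos \<alpha>)" "descends S T (cos \<beta>)" and "wedge R S' (cos \<alpha>')" "descends S' T (cos \<beta>')"
    and "0 \<le> \<alpha>" "0 \<le> \<beta>" "0 \<le> \<alpha>'" "0 \<le> \<beta>'" and sum: "\<alpha> + \<beta> + \<alpha>' + \<beta>' = 2 * pi"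
  shows "descends R T (cos (\<alpha> + \<beta>))"
proof -
  consider "\<alpha> + \<beta> < pi" | "\<alpha> + \<beta> = pi" | "\<alpha>' + \<beta>' < pi"
    using sum by linarith
  then show ?thesis
  proof cases
    case 1
    with assms show ?thesis by (intro descends_two_wedges)
  next
    case 2
    then show ?thesis using descends_through_gP by simp
  next
    case 3
    have "\<alpha> + \<beta> = 2 * pi - (\<alpha>' + \<beta>')"
      using sum by simp
    then have "cos (\<alpha> + \<beta>) = cos (\<alpha>' + \<beta>')"
      by (simp only: cos_2pi_minus)
    moreover have "descends R T (cos (\<alpha>' + \<beta>'))"
      using assms 3 by (intro descends_two_wedges)
    ultimately show ?thesis by simp
  qed
qed

text \<open>Adjacent sides are directly joined by a triangle; opposite sides are joined by two triangles on either
  side of the common vertex.\<close>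
lemma descends_direction:
  assumes "full_angle t"
  shows "descends R S (direction t R \<bullet> direction t S)"
proof -
  let ?a = "tri_angle (t vA)" and ?b = "tri_angle (t vD)" and ?c = "tri_angle (t vC)" and ?d = "tri_angle (t vB)"
  have sum: "?a + ?b + ?c + ?d = 2 * pi"
    using assms by (simp add: full_angle_def vertices_def)
  note next_wedges = wedge_nxt[of vA, simplified] wedge_nxt[of vD, simplified] wedge_nxt[of vC, simplified]
    wedge_nxt[of vB, simplified]
  note w = next_wedges next_wedges[THEN wedge_sym]
  note dw = w[THEN descends_adjacent]
  note nn = tri.tri_angle_nonneg
  have AC: "descends vA vC (cos (?a + ?b))" "descends vC vA (cos (?b + ?a))"
    using sum by (auto intro!: descends_opposite[OF w(1) dw(2) w(8) dw(7)]
        descends_opposite[OF w(6) dw(5) w(3) dw(4)] nn)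
  have BD: "descends vD vB (cos (?b + ?c))" "descends vB vD (cos (?c + ?b))"
    using sum by (auto intro!: descends_opposite[OF w(2) dw(3) w(5) dw(8)]
        descends_opposite[OF w(7) dw(6) w(4) dw(1)] nn)
  define \<phi> where "\<phi> = (\<lambda>R. case R of vA \<Rightarrow> 0 | vD \<Rightarrow> ?a | vC \<Rightarrow> ?a + ?b | vB \<Rightarrow> ?a + ?b + ?c)"
  have direction: "direction t R = cis (\<phi> R)" for R
    by (cases R) (simp_all add: \<phi>_def)
  have turn: "descends R S (cos (\<phi> R - \<phi> S))"
    if "descends R S (cos x)" and "\<phi> S - \<phi> R \<in> {x, 2 * pi - x} \<or> \<phi> R - \<phi> S \<in> {x, 2 * pi - x}" for R S x
  proof -
    have "cos (\<phi> R - \<phi> S) = cos (\<phi> S - \<phi> R)"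
      by (metis cos_minus minus_diff_eq)
    then have "cos (\<phi> R - \<phi> S) = cos x"
      using that(2) by (auto simp: cos_2pi_minus)
    then show ?thesis
      using that(1) by simp
  qed
  have "descends vA vD (cos (\<phi> vA - \<phi> vD))" "descends vD vC (cos (\<phi> vD - \<phi> vC))"
    "descends vC vB (cos (\<phi> vC - \<phi> vB))" "descends vB vA (cos (\<phi> vB - \<phi> vA))"
    "descends vD vA (cos (\<phi> vD - \<phi> vA))" "descends vC vD (cos (\<phi> vC - \<phi> vD))"
    "descends vB vC (cos (\<phi> vB - \<phi> vC))" "descends vA vB (cos (\<phi> vA - \<phi> vB))"
    by (rule turn, rule dw, use sum in \<open>simp add: \<phi>_def\<close>)+
  moreover have "descends vA vC (cos (\<phi> vA - \<phi> vC))" "descends vC vA (cos (\<phi> vC - \<phi> vA))"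
    "descends vD vB (cos (\<phi> vD - \<phi> vB))" "descends vB vD (cos (\<phi> vB - \<phi> vD))"
    by (rule turn, rule AC BD, simp add: \<phi>_def)+
  moreover have "descends R R (cos (\<phi> R - \<phi> R))" for R
    using descends_self by simp
  ultimately have "descends R S (cos (\<phi> R - \<phi> S))"
    by (cases R; cases S) simp_all
  then show ?thesis
    by (simp add: direction inner_complex_def cos_diff)
qed

section \<open>Balance of the weighted directions\<close>

text \<open>Near the common vertex on the side \<open>R\<close>, the objective exceeds its minimum by at most
  \<open>- s * (\<Sum>S\<in>vertices. w S * u S)\<close> to first order in the distance \<open>s\<close>, so
  this sum cannot be positive.\<close>
lemma FT4_descent:
  assumes FT: "inverse_FT4 t c w" and desc: "\<And>S. descends R S (u S)"
  shows "(\<Sum>S\<in>vertices. w S * u S) \<le> 0"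
proof -
  have w: "0 < w S" if "S \<in> vertices" for S
    using FT that by (simp add: inverse_FT4_def)
  have sum: "(\<Sum>S\<in>vertices. w S) = c"
    using FT by (simp add: inverse_FT4_def)
  have fin: "finite vertices" and ne: "vertices \<noteq> {}"
    by (simp_all add: vertices_def)
  have "0 < c"
    unfolding sum[symmetric] using w fin ne by (intro sum_pos)
  show ?thesis
  proof (rule field_le_epsilon)
    fix e' :: real assume "0 < e'"
    define e where "e = e' / c"
    have "0 < e"
      using \<open>0 < e'\<close> \<open>0 < c\<close> by (simp add: e_def)
    have "\<forall>S. \<exists>d>0. \<forall>s. 0 < s \<and> s < d \<longrightarrow>
        joined_within t (on_side R s) (gvert t S) (len S - s * (u S - e))"
      using desc \<open>0 < e\<close> unfolding descends_def by blast
    then obtain d where d: "\<And>S. 0 < d S" "\<And>S s. 0 < s \<and> s < d S \<Longrightarrow>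
        joined_within t (on_side R s) (gvert t S) (len S - s * (u S - e))"
      unfolding choice_iff by blast
    define m where "m = min (len R) (Min (d ` vertices))"
    have "0 < m"
      using d(1) fin ne tri.a_pos[of R] by (simp add: m_def)
    define s where "s = m / 2"
    have s: "0 < s" "s < m"
      using \<open>0 < m\<close> by (simp_all add: s_def)
    have "FT_objective t w (gP t) \<le> FT_objective t w (on_side R s)"
      using FT on_side_in_glued[of s R] s by (simp add: inverse_FT4_def m_def)
    also have "\<dots> \<le> (\<Sum>S\<in>vertices. w S * (len S - s * (u S - e)))"
      unfolding FT_objective_def
    proof (intro sum_mono mult_left_mono)
      fix S assume S: "S \<in> vertices"
      then have "Min (d ` vertices) \<le> d S"
        using fin by simp
      then have "s < d S"
        using s(2) by (simp add: m_def)
      then show "gdist t (on_side R s) (gvert t S) \<le> len S - s * (u S - e)"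
        using s(1) by (intro gdist_le d(2)) simp
      show "0 \<le> w S"
        using w[OF S] by simp
    qed
    also have "\<dots> = (\<Sum>S\<in>vertices. w S * len S) - s * ((\<Sum>S\<in>vertices. w S * u S) - e * c)"
      by (simp add: sum[symmetric] sum_subtractf sum.distrib sum_distrib_left algebra_simps)
    finally have "s * ((\<Sum>S\<in>vertices. w S * u S) - e * c) \<le> 0"
      by (simp add: FT_objective_def gdist_gP_gvert)
    then have "(\<Sum>S\<in>vertices. w S * u S) - e * c \<le> 0"
      using s(1) by (simp add: mult_le_0_iff)
    then show "(\<Sum>S\<in>vertices. w S * u S) \<le> 0 + e'"
      using \<open>0 < c\<close> by (simp add: e_def)
  qed
qed

text \<open>Moving the point along each of the four sides shows that the resultant of the weighted directions
  has a nonpositive product with each direction; being a positive combination of the directions, it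
  has then nonpositive product with itself.\<close>
lemma FT4_balance:
  assumes "full_angle t" and FT: "inverse_FT4 t c w"
  shows "(\<Sum>R\<in>vertices. w R *\<^sub>R direction t R) = 0"
proof -
  let ?W = "\<Sum>R\<in>vertices. w R *\<^sub>R direction t R"
  have "direction t R \<bullet> ?W \<le> 0" for R
    using FT4_descent[OF FT descends_direction[OF assms(1), of R]] by (simp add: inner_sum_right)
  then have "?W \<bullet> ?W \<le> 0"
    using FT by (simp add: inner_sum_left inverse_FT4_def sum_nonpos mult_nonneg_nonpos less_imp_le)
  then show ?thesis
    using inner_ge_zero[of ?W] by (metis antisym inner_eq_zero_iff)
qed

end

section \<open>The glued manifolds and the weight ratios\<close>

lemma glued_triangles_exist:
  assumes "\<And>k. \<exists>X. triangle_on X (t k) \<and> idist X (apex (t k)) (lvert (t k)) = len k \<and>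
    idist X (rvert (t k)) (apex (t k)) = len (nxt k)"
  obtains g h where "glued_triangles t len g h"
proof -
  have "\<forall>k. \<exists>gh. side_params (t k) (len k) (len (nxt k)) (fst gh) (snd gh)"
  proof
    fix k
    obtain X where "triangle_on X (t k)" and len: "idist X (apex (t k)) (lvert (t k)) = len k"
      "idist X (rvert (t k)) (apex (t k)) = len (nxt k)"
      using assms by blast
    then obtain g h where "side_params (t k) (len k) (len (nxt k)) g h"
      using triangle_on_side_params[of X "t k"] unfolding len by blast
    then show "\<exists>gh. side_params (t k) (len k) (len (nxt k)) (fst gh) (snd gh)"
      by (intro exI[of _ "(g, h)"]) simp
  qed
  then obtain gh where "\<forall>k. side_params (t k) (len k) (len (nxt k)) (fst (gh k)) (snd (gh k))"
    unfolding choice_iff by blast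
  then have "glued_triangles t len (\<lambda>k. fst (gh k)) (\<lambda>k. snd (gh k))"
    by unfold_locales simp
  then show thesis by (rule that)
qed

text \<open>Comparison triangles have the side lengths of their originals, so the lengths of neighbouring triangles
  match also where a triangle of the surface meets a spherical one. In both manifolds the last two
  triangles are spherical.\<close>
lemma glued_manifold_triangles:
  assumes "0 < K1" "K1 < K2"
    and glued: "glued_one_prime M K1 K2 m t \<or> glued_two_prime M K1 K2 m t"
  obtains len g h where "glued_triangles t len g h" and "full_angle t"
    and "0 < tri_angle (t vC)" and "0 < tri_angle (t vB)"
proof -
  have sub: "subdivided_quadrilateral M K1 m" and full: "full_angle t"
    using glued by (auto simp: glued_one_prime_def glued_two_prime_def)
  define len where "len = (\<lambda>k. idist M (apex (m k)) (lvert (m k)))"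
  have tri_m: "triangle_on M (m k)" and next_m: "apex (m (nxt k)) = apex (m k)" "lvert (m (nxt k)) = rvert (m k)" for k
    using sub by (simp_all add: subdivided_quadrilateral_def)
  have left: "idist M (apex (m k)) (lvert (m k)) = len k" for k
    by (simp add: len_def)
  have right: "idist M (rvert (m k)) (apex (m k)) = len (nxt k)" for k
    by (simp add: len_def next_m idist_def inner_dist_commute)
  define good where "good = (\<lambda>k. \<exists>X. triangle_on X (t k) \<and> idist X (apex (t k)) (lvert (t k)) = len k \<and>
    idist X (rvert (t k)) (apex (t k)) = len (nxt k))"
  have comparison: "good k" if "comparison_triangle M (m k) \<kappa> (t k)" for k \<kappa>
    unfolding good_def using that
    by (intro exI[of _ "model_sphere \<kappa>"]) (simp add: comparison_triangle_def left right)
  have same: "good k" if "t k = m k" for k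
    unfolding good_def using that tri_m
    by (intro exI[of _ M]) (simp add: left right)
  have "good k" for k
    using glued unfolding glued_one_prime_def glued_two_prime_def
    by (cases k) (auto intro: comparison same)
  then obtain g h where "glued_triangles t len g h"
    unfolding good_def using glued_triangles_exist by blast
  moreover have "0 < tri_angle (t k)" if "comparison_triangle M (m k) K1 (t k) \<or> comparison_triangle M (m k) K2 (t k)" for k
    using that assms(1,2) spherical_triangle_angle_pos[of K1 "t k"] spherical_triangle_angle_pos[of K2 "t k"]
    by (auto simp: comparison_triangle_def)
  then have "0 < tri_angle (t vC)" "0 < tri_angle (t vB)"
    using glued by (auto simp: glued_one_prime_def glued_two_prime_def)
  ultimately show thesis
    using full that by blast
qed

text \<open>If all directions were on one line, every angle would be \<open>0\<close> or \<open>\<pi>\<close>. The two angles that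
  are positive would be \<open>\<pi>\<close>, the other two \<open>0\<close>, and three directions would coincide.\<close>
lemma (in glued_triangles) directions_not_collinear:
  assumes "full_angle t" and "0 < tri_angle (t vC)" and "0 < tri_angle (t vB)"
    and "\<not> (direction t vC = 1 \<and> direction t vD = 1)"
  shows "\<not> (Im (direction t vB) = 0 \<and> Im (direction t vC) = 0 \<and> Im (direction t vD) = 0)"
proof
  let ?a = "tri_angle (t vA)" and ?b = "tri_angle (t vD)" and ?c = "tri_angle (t vC)" and ?d = "tri_angle (t vB)"
  assume "Im (direction t vB) = 0 \<and> Im (direction t vC) = 0 \<and> Im (direction t vD) = 0"
  then have sin: "sin (?a + ?b + ?c) = 0" "sin (?a + ?b) = 0"
    by simp_all
  have sum: "?a + ?b + ?c + ?d = 2 * pi"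
    using assms(1) by (simp add: full_angle_def vertices_def)
  have "?c = (?a + ?b + ?c) - (?a + ?b)" "?d = 2 * pi - (?a + ?b + ?c)"
    using sum by simp_all
  then have "sin ?c = 0" "sin ?d = 0"
    using sin by (metis sin_diff mult_zero_left mult_zero_right diff_zero, metis sin_2pi_minus neg_equal_0_iff_equal)
  then have "\<not> ?c < pi" "\<not> ?d < pi"
    using assms(2,3) sin_gt_zero[of ?c] sin_gt_zero[of ?d] by auto
  then have "?c = pi" "?d = pi"
    using tri.tri_angle_le_pi[of vC] tri.tri_angle_le_pi[of vB] by linarith+
  then have "?a = 0" "?b = 0"
    using sum tri.tri_angle_nonneg[of vA] tri.tri_angle_nonneg[of vD] by simp_all
  then show False
    using assms(4) by simp
qed

text \<open>Cramer's rule: each relation is multiplied with \<open>v\<close> by the cross product, which eliminates the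
  weight of \<open>v\<close>. The cross product of \<open>1\<close> and \<open>v\<close> is not zero: otherwise, as \<open>s'\<close> and \<open>b\<close> are not
  zero, \<open>z\<close> and \<open>u\<close> would lie on the same line.\<close>
lemma weight_ratio:
  fixes u v z :: complex and a b c d p q r p' r' s' :: real
  assumes four: "of_real a + b *\<^sub>R u + c *\<^sub>R v + d *\<^sub>R z = 0"
    and three: "of_real p + q *\<^sub>R u + r *\<^sub>R v = 0"
    and three': "of_real p' + r' *\<^sub>R v + s' *\<^sub>R z = 0"
    and "a \<noteq> 0" "b \<noteq> 0" "p \<noteq> 0" "s' \<noteq> 0" and "v \<noteq> 0"
    and noncollinear: "\<not> (Im u = 0 \<and> Im v = 0 \<and> Im z = 0)"
  shows "b / a = q / p * (1 - d / a * (p' / s'))"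
proof -
  define X where "X = (\<lambda>x. Re x * Im v - Im x * Re v)"
  have X: "X (x + y) = X x + X y" "X (k *\<^sub>R x) = k * X x" "X (of_real k) = k * Im v" "X v = 0" "X 0 = 0"
    for x y :: complex and k :: real
    by (simp_all add: X_def algebra_simps)
  have 1: "a * Im v + b * X u + d * X z = 0" and 2: "p * Im v + q * X u = 0" and 3: "p' * Im v + s' * X z = 0"
    using arg_cong[OF four, of X] arg_cong[OF three, of X] arg_cong[OF three', of X] by (simp_all add: X)
  have "Im v \<noteq> 0"
  proof
    assume v: "Im v = 0"
    then have "X z = 0"
      using 3 \<open>s' \<noteq> 0\<close> by simp
    moreover from this have "X u = 0"
      using 1 v \<open>b \<noteq> 0\<close> by simp
    moreover have "Re v \<noteq> 0"
      using v \<open>v \<noteq> 0\<close> by (simp add: complex_eq_iff)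
    ultimately show False
      using v noncollinear by (simp add: X_def)
  qed
  define U where "U = X u / Im v"
  define Z where "Z = X z / Im v"
  have U: "X u = U * Im v" and Z: "X z = Z * Im v"
    using \<open>Im v \<noteq> 0\<close> by (simp_all add: U_def Z_def)
  have "(a + b * U + d * Z) * Im v = 0" "(p + q * U) * Im v = 0" "(p' + s' * Z) * Im v = 0"
    using 1 2 3 unfolding U Z by (simp_all add: algebra_simps)
  then have eqs: "a + b * U + d * Z = 0" "p + q * U = 0" "p' + s' * Z = 0"
    using \<open>Im v \<noteq> 0\<close> by simp_all
  have "q \<noteq> 0"
    using eqs(2) \<open>p \<noteq> 0\<close> by auto
  have "U = - p / q" "Z = - p' / s'"
    using eqs(2,3) \<open>q \<noteq> 0\<close> \<open>s' \<noteq> 0\<close> by (simp_all add: field_simps eq_neg_iff_add_eq_0)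
  then have "b * p / q = a - d * (p' / s')"
    using eqs(1) by simp
  then have "b = q / p * (a - d * (p' / s'))"
    using \<open>q \<noteq> 0\<close> \<open>p \<noteq> 0\<close> by (metis nonzero_divide_eq_eq nonzero_mult_div_cancel_left times_divide_eq_left mult.commute)
  then have "b / a = q / p * ((a - d * (p' / s')) / a)"
    by simp
  also have "(a - d * (p' / s')) / a = 1 - d / a * (p' / s')"
    using \<open>a \<noteq> 0\<close> by (simp add: diff_divide_distrib)
  finally show ?thesis .
qed

theorem corollary2:
  fixes M :: "point set" and K1 K2 c :: real
    and m t :: "vertex \<Rightarrow> tri"
    and w wABC wACD wABD :: "vertex \<Rightarrow> real"
  assumes "0 < K1" and "K1 < K2"
    and "complete_convex_surface M"
    and "bounded_specific_curvature M K1 K2"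
    and "glued_one_prime M K1 K2 m t \<or> glued_two_prime M K1 K2 m t"
    and "P_interior_triangle t vA vB vC"
    and "0 < c"
    and "inverse_FT4 t c w"
    and "inverse_FT3 t c {vA, vB, vC} wABC"
    and "inverse_FT3 t c {vA, vC, vD} wACD"
    and "inverse_FT3 t c {vA, vB, vD} wABD"
    and "wABC vA \<noteq> 0" and "wACD vD \<noteq> 0" and "wABD vD \<noteq> 0"
  shows "w vB / w vA = wABC vB / wABC vA * (1 - w vD / w vA * (wACD vA / wACD vD)) \<and>
         w vC / w vA = wABC vC / wABC vA * (1 - w vD / w vA * (wABD vA / wABD vD)) \<and>
         w vA + w vB + w vC + w vD = c"
proof -
  obtain len g h where "glued_triangles t len g h" and full: "full_angle t"
    and pos: "0 < tri_angle (t vC)" "0 < tri_angle (t vB)"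
    using glued_manifold_triangles[OF assms(1,2,5)] by blast
  then interpret glued_triangles t len g h
    by simp
  define uB where "uB = direction t vB"
  define uC where "uC = direction t vC"
  define uD where "uD = direction t vD"
  have unit: "uB \<noteq> 0" "uC \<noteq> 0"
    by (simp_all add: uB_def uC_def)
  have w: "0 < w vA" "0 < w vB" "0 < w vC" "w vA + w vB + w vC + w vD = c"
    using assms(8) by (simp_all add: inverse_FT4_def vertices_def add_ac)
  have four: "of_real (w vA) + w vB *\<^sub>R uB + w vC *\<^sub>R uC + w vD *\<^sub>R uD = 0"
    using FT4_balance[OF full assms(8)]
    by (simp add: vertices_def uB_def uC_def uD_def scaleR_conv_of_real add.assoc)
  have ABC: "of_real (wABC vA) + wABC vB *\<^sub>R uB + wABC vC *\<^sub>R uC = 0"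
    using assms(9) by (simp add: inverse_FT3_def uB_def uC_def scaleR_conv_of_real add.assoc)
  have ACD: "of_real (wACD vA) + wACD vC *\<^sub>R uC + wACD vD *\<^sub>R uD = 0"
    and ACD_sum: "wACD vA + wACD vC + wACD vD = c"
    using assms(10) by (simp_all add: inverse_FT3_def uC_def uD_def scaleR_conv_of_real add.assoc)
  have ABD: "of_real (wABD vA) + wABD vB *\<^sub>R uB + wABD vD *\<^sub>R uD = 0"
    using assms(11) by (simp add: inverse_FT3_def uB_def uD_def scaleR_conv_of_real add.assoc)
  (* Weights on three equal directions that balance would have sum 0. *)
  have "\<not> (uC = 1 \<and> uD = 1)"
  proof
    assume "uC = 1 \<and> uD = 1"
    then have "Re (of_real (wACD vA) + wACD vC *\<^sub>R uC + wACD vD *\<^sub>R uD) = c"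
      using ACD_sum by simp
    then show False
      unfolding ACD using \<open>0 < c\<close> by simp
  qed
  then have nc: "\<not> (Im uB = 0 \<and> Im uC = 0 \<and> Im uD = 0)"
    using directions_not_collinear[OF full pos] unfolding uB_def uC_def uD_def by simp
  show ?thesis
  proof (intro conjI w(4))
    show "w vB / w vA = wABC vB / wABC vA * (1 - w vD / w vA * (wACD vA / wACD vD))"
      using four ABC ACD by (rule weight_ratio) (use w unit nc assms(12,13) in auto)
    have "of_real (w vA) + w vC *\<^sub>R uC + w vB *\<^sub>R uB + w vD *\<^sub>R uD = 0"
      "of_real (wABC vA) + wABC vC *\<^sub>R uC + wABC vB *\<^sub>R uB = 0"
      using four ABC by (simp_all only: add_ac)
    (* The second ratio is the first one with the roles of B and C exchanged. *)
    then show "w vC / w vA = wABC vC / wABC vA * (1 - w vD / w vA * (wABD vA / wABD vD))"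
      using ABD by (rule weight_ratio) (use w unit nc assms(12,14) in auto)
  qed
qed

end
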